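(* Let $L = \mathrm{Cur}(\mathrm{sl}_2(\mathbb{C}))$. Up to conjugation with an automorphism of $L$ (that is, after replacing $R$ by $\psi^{-1}R\psi$ for some automorphism $\psi$ of $L$), every nontrivial Rota--Baxter operator $R$ of weight $1$ on $L$ is either the $\partial$-linear extension of a Rota--Baxter operator of weight $1$ on the Lie algebra $\mathrm{sl}_2(\mathbb{C})$, or the following $\partial$-linear map for some nonzero polynomial $q(\partial)\in\mathbb{C}[\partial]$: (Q1) $R(e) = -e$, $R(f) = 0$, $R(h) = q(\partial)h$.
   Context: All vector spaces are over $\mathbb{C}$. Fix the basis $e,f,h$ of $\mathrm{sl}_2(\mathbb{C})$ with $[e,f]=h$, $[h,e]=2e$, $[h,f]=-2f$. A Rota--Baxter operator of weight $k\in\mathbb{C}$ on a Lie algebra $\mathfrak{g}$ is a linear map $R:\mathfrak{g}\to\mathfrak{g}$ with $[R(a),R(b)] = R([R(a),b]+[a,R(b)]+k[a,b])$ for all $a,b\in\mathfrak{g}$. A Lie conformal algebra is a (free) $\mathbb{C}[\partial]$-module $L$ with a $\mathbb{C}$-bilinear $\lambda$-bracket $[\cdot_\lambda\cdot]: L\otimes L\to\mathbb{C}[\lambda]\otimes L$ such that $[\partial a_\lambda b]=-\lambda[a_\lambda b]$, $[a_\lambda\partial b]=(\lambda+\partial)[a_\lambda b]$, $[a_\lambda b]=-[b_{-\lambda-\partial}a]$ and $[a_\lambda[b_\mu c]]-[b_\mu[a_\lambda c]]=[[a_\lambda b]_{\lambda+\mu}c]$. An automorphism of $L$ is a bijective $\mathbb{C}[\partial]$-linear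 map preserving the $\lambda$-bracket. For a Lie algebra $\mathfrak{g}$, the current Lie conformal algebra $\mathrm{Cur}(\mathfrak{g})$ is the free $\mathbb{C}[\partial]$-module $\mathbb{C}[\partial]\mathfrak{g}=\mathbb{C}[\partial]\otimes\mathfrak{g}$ with $[f(\partial)a_\lambda g(\partial)b]=f(-\lambda)g(\lambda+\partial)[a,b]$ for $a,b\in\mathfrak{g}$ and polynomials $f,g$. A Rota--Baxter operator of weight $k\in\mathbb{C}$ on a Lie conformal algebra $L$ is a $\mathbb{C}[\partial]$-linear map $R:L\to L$ with $[R(a)_\lambda R(b)] = R([R(a)_\lambda b]+[a_\lambda R(b)]+k[a_\lambda b])$ for all $a,b\in L$, where $R$ acts on $\mathbb{C}[\lambda]\otimes L$ coefficientwise in $\lambda$. The operators $R=0$ and $R=-k\cdot\mathrm{id}$ are called the trivial Rota--Baxter operators of weight $k$; all others are nontrivial. The $\partial$-linear extension of a linear map $P:\mathfrak{g}\to\mathfrak{g}$ to $\mathrm{Cur}(\mathfrak{g})$ is $f(\partial)a\mapsto f(\partial)P(a)$ for $a\in\mathfrak{g}$. *)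

theory Defs
  imports "HOL-Analysis.Analysis" "HOL-Computational_Algebra.Polynomial"
begin

section \<open>Lie algebras over the complex numbers\<close>

locale lie_algebra = vector_space scale
  for scale :: "complex \<Rightarrow> 'g::ab_group_add \<Rightarrow> 'g" (infixr \<open>\<cdot>\<close> 75) +
  fixes bracket :: "'g \<Rightarrow> 'g \<Rightarrow> 'g"
  assumes bracket_add_left: "bracket (x + y) z = bracket x z + bracket y z"
    and bracket_add_right: "bracket x (y + z) = bracket x y + bracket x z"
    and bracket_scale_left: "bracket (c \<cdot> x) y = c \<cdot> bracket x y"
    and bracket_scale_right: "bracket x (c \<cdot> y) = c \<cdot> bracket x y"
    and bracket_self: "bracket x x = 0"
    and jacobi: "bracket x (bracket y z) + bracket y (bracket z x) + bracket z (bracket x y) = 0"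
begin

definition rota_baxter :: "complex \<Rightarrow> ('g \<Rightarrow> 'g) \<Rightarrow> bool" where
  "rota_baxter k R \<longleftrightarrow> Vector_Spaces.linear scale scale R \<and>
     (\<forall>a b. bracket (R a) (R b) = R (bracket (R a) b + bracket a (R b) + k \<cdot> bracket a b))"

end


section \<open>Lie conformal algebras\<close>

text \<open>
  The ring \<open>\<complex>[\<partial>]\<close> is \<^typ>\<open>complex poly\<close>, with \<open>\<partial> = [:0, 1:]\<close>. For an additive group \<^typ>\<open>'l\<close>,
  the group \<open>\<complex>[\<lambda>] \<otimes> L\<close> is \<^typ>\<open>'l poly\<close>: coefficients lie in \<open>L\<close>, the indeterminate is \<open>\<lambda>\<close>,
  multiplication by \<open>\<lambda>\<close> is \<^term>\<open>pCons 0\<close>, and a map on \<open>L\<close> acts coefficientwise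
  through \<^const>\<open>map_poly\<close>.
\<close>

text \<open>
  \<open>subst_skew D\<close> sends \<open>p(\<lambda>) = \<Sum> \<lambda>\<^sup>j c\<^sub>j\<close> to \<open>p(-\<lambda>-\<partial>) = \<Sum> (-\<lambda>-\<partial>)\<^sup>j c\<^sub>j\<close>, by Horner's rule,
  where \<open>D\<close> is the action of \<open>\<partial>\<close> on \<open>L\<close>.
\<close>

definition subst_skew :: "('l::ab_group_add \<Rightarrow> 'l) \<Rightarrow> 'l poly \<Rightarrow> 'l poly" where
  "subst_skew D p = fold_coeffs (\<lambda>c q. [:c:] - pCons 0 q - map_poly D q) p 0"

text \<open>
  The Jacobi axiom compares the coefficients of \<open>\<lambda>\<^sup>m \<mu>\<^sup>n\<close> in
  \<open>[a\<^sub>\<lambda>[b\<^sub>\<mu>c]] - [b\<^sub>\<mu>[a\<^sub>\<lambda>c]] = [[a\<^sub>\<lambda>b]\<^bsub>\<lambda>+\<mu>\<^esub>c]\<close>; on the right \<open>(\<lambda>+\<mu>)\<^sup>j\<close> is expanded by the binomial theorem.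
\<close>

locale lie_conformal_algebra = module scale
  for scale :: "complex poly \<Rightarrow> 'l::ab_group_add \<Rightarrow> 'l" (infixr \<open>\<cdot>\<close> 75) +
  fixes lbracket :: "'l \<Rightarrow> 'l \<Rightarrow> 'l poly"
  assumes lbracket_add_left: "lbracket (a + b) c = lbracket a c + lbracket b c"
    and lbracket_add_right: "lbracket a (b + c) = lbracket a b + lbracket a c"
    and lbracket_scale_left: "lbracket ([:z:] \<cdot> a) b = map_poly (scale [:z:]) (lbracket a b)"
    and lbracket_scale_right: "lbracket a ([:z:] \<cdot> b) = map_poly (scale [:z:]) (lbracket a b)"
    and lbracket_deriv_left: "lbracket ([:0, 1:] \<cdot> a) b = - pCons 0 (lbracket a b)"
    and lbracket_deriv_right:
      "lbracket a ([:0, 1:] \<cdot> b) = pCons 0 (lbracket a b) + map_poly (scale [:0, 1:]) (lbracket a b)"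
    and lbracket_skew: "lbracket a b = - subst_skew (scale [:0, 1:]) (lbracket b a)"
    and lbracket_jacobi:
      "coeff (lbracket a (coeff (lbracket b c) n)) m - coeff (lbracket b (coeff (lbracket a c) m)) n =
       (\<Sum>k\<le>m. of_nat ((m - k + n) choose n) \<cdot>
                 coeff (lbracket (coeff (lbracket a b) k) c) (m - k + n))"
begin

definition automorphism :: "('l \<Rightarrow> 'l) \<Rightarrow> bool" where
  "automorphism \<psi> \<longleftrightarrow> bij \<psi> \<and> module_hom scale scale \<psi> \<and>
     (\<forall>a b. lbracket (\<psi> a) (\<psi> b) = map_poly \<psi> (lbracket a b))"

definition rota_baxter :: "complex \<Rightarrow> ('l \<Rightarrow> 'l) \<Rightarrow> bool" where
  "rota_baxter k R \<longleftrightarrow> module_hom scale scale R \<and>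
     (\<forall>a b. lbracket (R a) (R b) =
        map_poly R (lbracket (R a) b + lbracket a (R b) + map_poly (scale [:k:]) (lbracket a b)))"

definition trivial_rota_baxter :: "complex \<Rightarrow> ('l \<Rightarrow> 'l) \<Rightarrow> bool" where
  "trivial_rota_baxter k R \<longleftrightarrow> R = (\<lambda>a. 0) \<or> R = (\<lambda>a. [:- k:] \<cdot> a)"

end


section \<open>Current Lie conformal algebras\<close>

text \<open>
  The free module \<open>\<complex>[\<partial>] \<otimes> \<gg>\<close> is \<^typ>\<open>'g poly\<close>, polynomials in \<open>\<partial>\<close> with coefficients in \<open>\<gg>\<close>.
  The module structure follows the recursion that defines polynomial multiplication, and
  \<open>tensor p x\<close> is \<open>p(\<partial>) \<otimes> x\<close>.
  In the \<open>\<lambda>\<close>-bracket of \<open>\<Sum> \<partial>\<^sup>i a\<^sub>i\<close> and \<open>\<Sum> \<partial>\<^sup>j b\<^sub>j\<close>, the factor \<open>(-\<lambda>)\<^sup>i (\<lambda>+\<partial>)\<^sup>j\<close> is a polynomial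
  with outer indeterminate \<open>\<lambda> = [:0, 1:]\<close> and inner indeterminate \<open>\<partial> = [:[:0, 1:]:]\<close>.
\<close>

context lie_algebra
begin

definition tensor :: "complex poly \<Rightarrow> 'g \<Rightarrow> 'g poly" where
  "tensor p x = map_poly (\<lambda>c. c \<cdot> x) p"

definition cur_scale :: "complex poly \<Rightarrow> 'g poly \<Rightarrow> 'g poly" where
  "cur_scale p u = fold_coeffs (\<lambda>c v. map_poly (scale c) u + pCons 0 v) p 0"

definition cur_lbracket :: "'g poly \<Rightarrow> 'g poly \<Rightarrow> 'g poly poly" where
  "cur_lbracket a b = (\<Sum>i\<le>degree a. \<Sum>j\<le>degree b.
     map_poly (\<lambda>r. tensor r (bracket (coeff a i) (coeff b j)))
       ((- [:0, 1:]) ^ i * [:[:0, 1:], 1:] ^ j))"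

text \<open>
  The \<open>\<partial>\<close>-linear extension \<open>p(\<partial>) \<otimes> x \<mapsto> p(\<partial>) \<otimes> P x\<close> of \<open>P\<close> applies \<open>P\<close> to each coefficient;
  see \<open>cur_extension_tensor\<close> below.
\<close>

definition cur_extension :: "('g \<Rightarrow> 'g) \<Rightarrow> 'g poly \<Rightarrow> 'g poly" where
  "cur_extension P = map_poly P"

end

lemma map_poly_add':
  assumes "f 0 = 0" "\<And>x y. f (x + y) = f x + f y"
  shows "map_poly f (p + q) = map_poly f p + map_poly f q"
  by (intro poly_eqI) (simp add: coeff_map_poly assms)

lemma map_poly_pCons0:
  "map_poly (pCons (0::'a::ab_group_add)) (pCons 0 p) = pCons 0 (map_poly (pCons 0) p)"
  by (simp add: map_poly_pCons)

lemma subst_skew_0 [simp]: "subst_skew D 0 = 0"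
  by (simp add: subst_skew_def)

lemma subst_skew_pCons [simp]:
  assumes "D 0 = 0"
  shows "subst_skew D (pCons c p) = [:c:] - pCons 0 (subst_skew D p) - map_poly D (subst_skew D p)"
  by (cases "c = 0 \<and> p = 0") (auto simp: subst_skew_def)

lemma subst_skew_add:
  assumes D: "D 0 = 0" "\<And>x y. D (x + y) = D x + D y"
  shows "subst_skew D (p + q) = subst_skew D p + subst_skew D q"
proof (induction p arbitrary: q)
  case (pCons a p)
  obtain b r where "q = pCons b r" by (cases q)
  then show ?case by (simp add: D map_poly_add' pCons.IH)
qed simp

lemma subst_skew_uminus:
  assumes D: "D 0 = 0" "\<And>x y. D (x + y) = D x + D y"
  shows "subst_skew D (- p) = - subst_skew D p"
  using subst_skew_add[of D p "- p", OF D] by (simp add: eq_neg_iff_add_eq_0 add.commute)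

lemma subst_skew_map:
  assumes D: "D 0 = 0" "\<And>x y. D (x + y) = D x + D y"
  shows "subst_skew D (map_poly D p) = map_poly D (subst_skew D p)"
proof (induction p)
  case (pCons a p)
  have Dm: "D (- x) = - D x" for x
    using D(2)[of x "- x"] by (simp add: D(1) eq_neg_iff_add_eq_0 add.commute)
  have Dd: "D (x - y) = D x - D y" for x y
    using D(2)[of x "- y"] by (simp add: Dm)
  have md: "map_poly D (u - v) = map_poly D u - map_poly D v" for u v
    by (intro poly_eqI) (simp add: coeff_map_poly D Dd)
  have mu: "map_poly D (- u) = - map_poly D u" for u
    by (intro poly_eqI) (simp add: coeff_map_poly D Dm)
  show ?case by (simp add: D map_poly_pCons pCons.IH md mu Dm)
qed simp

context lie_algebra
begin

lemma bracket_0 [simp]: "bracket 0 x = 0" "bracket x 0 = 0"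
  using bracket_add_left[of 0 0 x] bracket_add_right[of x 0 0] by simp_all

lemma bracket_swap: "bracket x y = - bracket y x"
  using bracket_self[of "x + y", unfolded bracket_add_left bracket_add_right]
  by (simp add: bracket_self eq_neg_iff_add_eq_0 add.commute)

lemma bracket_minus: "bracket x (- y) = - bracket x y"
  using bracket_add_right[of x y "- y"] by (simp add: eq_neg_iff_add_eq_0 add.commute)

lemma cur_scale_0 [simp]: "cur_scale 0 u = 0"
  by (simp add: cur_scale_def)

lemma cur_scale_pCons [simp]:
  "cur_scale (pCons c p) u = map_poly (scale c) u + pCons 0 (cur_scale p u)"
proof -
  have "map_poly (scale 0) u = 0" by (intro poly_eqI) (simp add: coeff_map_poly)
  then show ?thesis by (cases "c = 0 \<and> p = 0") (auto simp: cur_scale_def)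
qed

lemma map_poly_scale_add:
  "map_poly (scale c) (u + v) = map_poly (scale c) u + map_poly (scale c) v"
  "map_poly (scale (c + d)) u = map_poly (scale c) u + map_poly (scale d) u"
  "map_poly (scale 0) u = 0" "map_poly (scale 1) u = u"
  "map_poly (scale c) (map_poly (scale d) u) = map_poly (scale (c * d)) u"
  "map_poly (scale c) (pCons x u) = pCons (c \<cdot> x) (map_poly (scale c) u)"
  by (auto intro!: poly_eqI simp: coeff_map_poly scale_right_distrib scale_left_distrib
      coeff_pCons split: nat.splits)

lemma cur_scale_add_right: "cur_scale p (u + v) = cur_scale p u + cur_scale p v"
  by (induction p) (simp_all add: map_poly_scale_add)

lemma cur_scale_add_left: "cur_scale (p + q) u = cur_scale p u + cur_scale q u"
proof (induction p arbitrary: q)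
  case (pCons a p)
  obtain b r where "q = pCons b r" by (cases q)
  then show ?case by (simp add: map_poly_scale_add pCons.IH)
qed simp

lemma cur_scale_pCons_0: "cur_scale p (pCons 0 u) = pCons 0 (cur_scale p u)"
  by (induction p) (simp_all add: map_poly_scale_add)

lemma cur_scale_smult: "cur_scale (smult c q) u = map_poly (scale c) (cur_scale q u)"
  by (induction q) (simp_all add: map_poly_scale_add)

lemma cur_scale_scale: "cur_scale p (cur_scale q u) = cur_scale (p * q) u"
  by (induction p) (simp_all add: cur_scale_add_left cur_scale_smult map_poly_scale_add)

lemma module_cur_scale: "module cur_scale"
  by unfold_locales
    (simp_all add: cur_scale_add_right cur_scale_add_left cur_scale_scale one_pCons map_poly_scale_add)

lemma cur_scale_deriv: "cur_scale [:0, 1:] = pCons 0"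
  by (rule ext) (simp add: map_poly_scale_add)

lemma cur_scale_const: "cur_scale [:c:] = map_poly (scale c)"
  by (rule ext) simp

lemma tensor_simps:
  "tensor 0 x = 0" "tensor (p + q) x = tensor p x + tensor q x" "tensor (- p) x = - tensor p x"
  "tensor p 0 = 0" "tensor p (x + y) = tensor p x + tensor p y"
  "tensor p (c \<cdot> x) = map_poly (scale c) (tensor p x)"
  "tensor (pCons c p) x = pCons (c \<cdot> x) (tensor p x)"
  by (auto intro!: poly_eqI simp: tensor_def coeff_map_poly scale_right_distrib scale_left_distrib
      coeff_pCons mult.commute split: nat.splits)

lemma cur_scale_tensor: "cur_scale p (tensor q x) = tensor (p * q) x"
proof -
  have "map_poly (scale c) (tensor r x) = tensor (smult c r) x" for c r
    by (intro poly_eqI) (simp add: tensor_def coeff_map_poly)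
  then show ?thesis by (induction p) (simp_all add: tensor_simps)
qed

definition lift2 :: "complex poly poly \<Rightarrow> 'g \<Rightarrow> 'g poly poly" where
  "lift2 P x = map_poly (\<lambda>r. tensor r x) P"

lemma lift2_simps:
  "lift2 P 0 = 0" "lift2 P (x + y) = lift2 P x + lift2 P y"
  "lift2 (P + Q) x = lift2 P x + lift2 Q x" "lift2 (- P) x = - lift2 P x" "lift2 0 x = 0"
  "lift2 (pCons 0 P) x = pCons 0 (lift2 P x)"
  "lift2 (smult [:0, 1:] P) x = map_poly (pCons 0) (lift2 P x)"
  "lift2 P (c \<cdot> x) = map_poly (map_poly (scale c)) (lift2 P x)"
  by (auto intro!: poly_eqI simp: lift2_def coeff_map_poly tensor_simps coeff_pCons split: nat.splits)

lemma cur_lbracket_bounds: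
  assumes "degree a \<le> m" "degree b \<le> n"
  shows "cur_lbracket a b = (\<Sum>i\<le>m. \<Sum>j\<le>n.
     lift2 ((- [:0, 1:]) ^ i * [:[:0, 1:], 1:] ^ j) (bracket (coeff a i) (coeff b j)))"
proof -
  have "cur_lbracket a b = (\<Sum>i\<le>degree a. \<Sum>j\<le>n.
     lift2 ((- [:0, 1:]) ^ i * [:[:0, 1:], 1:] ^ j) (bracket (coeff a i) (coeff b j)))"
    unfolding cur_lbracket_def lift2_def[symmetric]
    by (intro sum.cong refl sum.mono_neutral_left)
      (use assms in \<open>auto simp: coeff_eq_0 lift2_simps\<close>)
  also have "\<dots> = (\<Sum>i\<le>m. \<Sum>j\<le>n.
     lift2 ((- [:0, 1:]) ^ i * [:[:0, 1:], 1:] ^ j) (bracket (coeff a i) (coeff b j)))"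
    by (intro sum.mono_neutral_left)
      (use assms in \<open>auto simp: coeff_eq_0 lift2_simps\<close>)
  finally show ?thesis .
qed

lemma cur_lbracket_add_left: "cur_lbracket (a + b) c = cur_lbracket a c + cur_lbracket b c"
proof -
  let ?m = "max (degree a) (degree b)"
  have "degree (a + b) \<le> ?m" by (simp add: degree_add_le)
  then show ?thesis
    by (simp add: cur_lbracket_bounds[of _ ?m _ "degree c"] bracket_add_left lift2_simps sum.distrib)
qed

lemma cur_lbracket_add_right: "cur_lbracket a (b + c) = cur_lbracket a b + cur_lbracket a c"
proof -
  let ?m = "max (degree b) (degree c)"
  have "degree (b + c) \<le> ?m" by (simp add: degree_add_le)
  then show ?thesis
    by (simp add: cur_lbracket_bounds[of _ "degree a" _ ?m] bracket_add_right lift2_simps sum.distrib)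
qed

lemma cur_lbracket_0 [simp]: "cur_lbracket 0 a = 0" "cur_lbracket a 0 = 0"
  by (simp_all add: cur_lbracket_def lift2_def[symmetric] lift2_simps)

lemma cur_lbracket_minus:
  "cur_lbracket (- a) b = - cur_lbracket a b" "cur_lbracket a (- b) = - cur_lbracket a b"
  using cur_lbracket_add_left[of a "- a" b] cur_lbracket_add_right[of a b "- b"]
  by (simp_all add: eq_neg_iff_add_eq_0 add.commute)

lemma cur_lbracket_const: "cur_lbracket [:x:] [:y:] = [:[:bracket x y:]:]"
  by (simp add: cur_lbracket_def one_pCons tensor_def map_poly_pCons)

lemma cur_lbracket_deriv_left: "cur_lbracket (pCons 0 a) b = - pCons 0 (cur_lbracket a b)"
proof -
  have "lift2 ((- [:0, 1:]) ^ Suc i * P) x = - pCons 0 (lift2 ((- [:0, 1:]) ^ i * P) x)" for i P x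
  proof -
    have "(- [:0, 1:]) ^ Suc i * P = - pCons 0 ((- [:0, 1:]) ^ i * P)" by simp
    then show ?thesis by (simp only: lift2_simps)
  qed
  moreover have "(\<Sum>i\<in>A. - pCons 0 (f i)) = - pCons 0 (\<Sum>i\<in>A. f i)"
    for f :: "nat \<Rightarrow> 'g poly poly" and A
    by (induction A rule: infinite_finite_induct) auto
  ultimately show ?thesis
    unfolding cur_lbracket_bounds[of a "degree a" b "degree b", OF order_refl order_refl]
      cur_lbracket_bounds[of "pCons 0 a" "Suc (degree a)" b "degree b", OF degree_pCons_le order_refl]
      sum.atMost_Suc_shift
    by (simp only: coeff_pCons_0 coeff_pCons_Suc bracket_0 lift2_simps sum.neutral_const add_0)
qed

lemma cur_lbracket_deriv_right:
  "cur_lbracket a (pCons 0 b) = pCons 0 (cur_lbracket a b) + map_poly (pCons 0) (cur_lbracket a b)"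
proof -
  have "lift2 (Q * [:[:0, 1:], 1:] ^ Suc i) x =
    pCons 0 (lift2 (Q * [:[:0, 1:], 1:] ^ i) x) + map_poly (pCons 0) (lift2 (Q * [:[:0, 1:], 1:] ^ i) x)"
    for i Q x
  proof -
    have "Q * [:[:0, 1:], 1:] ^ Suc i =
      pCons 0 (Q * [:[:0, 1:], 1:] ^ i) + smult [:0, 1:] (Q * [:[:0, 1:], 1:] ^ i)"
      by (simp add: algebra_simps)
    then show ?thesis by (simp only: lift2_simps)
  qed
  moreover have "(\<Sum>i\<in>A. pCons 0 (f i) + map_poly (pCons 0) (f i)) =
      pCons 0 (\<Sum>i\<in>A. f i) + map_poly (pCons 0) (\<Sum>i\<in>A. f i)"
    for f :: "nat \<Rightarrow> 'g poly poly" and A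
    by (induction A rule: infinite_finite_induct) (auto simp: map_poly_add')
  ultimately show ?thesis
    unfolding cur_lbracket_bounds[of a "degree a" b "degree b", OF order_refl order_refl]
      cur_lbracket_bounds[of a "degree a" "pCons 0 b" "Suc (degree b)", OF order_refl degree_pCons_le]
      sum.atMost_Suc_shift
    by (simp only: coeff_pCons_0 coeff_pCons_Suc bracket_0 lift2_simps sum.neutral_const add_0)
qed

lemma cur_lbracket_scale_left:
  "cur_lbracket (map_poly (scale c) a) b = map_poly (map_poly (scale c)) (cur_lbracket a b)"
proof -
  have "degree (map_poly (scale c) a) \<le> degree a" by (rule map_poly_degree_leq)
  moreover have "map_poly (map_poly (scale c)) (\<Sum>i\<in>A. f i) = (\<Sum>i\<in>A. map_poly (map_poly (scale c)) (f i))"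
    for f :: "nat \<Rightarrow> 'g poly poly" and A
    by (induction A rule: infinite_finite_induct) (auto simp: map_poly_add' map_poly_scale_add)
  ultimately show ?thesis
    by (simp add: cur_lbracket_bounds[of _ "degree a" b "degree b"] coeff_map_poly bracket_scale_left lift2_simps)
qed

lemma cur_lbracket_scale_right:
  "cur_lbracket a (map_poly (scale c) b) = map_poly (map_poly (scale c)) (cur_lbracket a b)"
proof -
  have "degree (map_poly (scale c) b) \<le> degree b" by (rule map_poly_degree_leq)
  moreover have "map_poly (map_poly (scale c)) (\<Sum>i\<in>A. f i) = (\<Sum>i\<in>A. map_poly (map_poly (scale c)) (f i))"
    for f :: "nat \<Rightarrow> 'g poly poly" and A
    by (induction A rule: infinite_finite_induct) (auto simp: map_poly_add' map_poly_scale_add)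
  ultimately show ?thesis
    by (simp add: cur_lbracket_bounds[of a "degree a" _ "degree b"] coeff_map_poly bracket_scale_right lift2_simps)
qed

text \<open>The defining formula \<open>[p(\<partial>)x\<^sub>\<lambda> q(\<partial>)y] = p(-\<lambda>) q(\<lambda>+\<partial>) [x,y]\<close>.\<close>

lemma cur_lbracket_tensor:
  "cur_lbracket (tensor p x) (tensor q y) =
     map_poly (\<lambda>r. tensor r (bracket x y))
       (pcompose (map_poly (\<lambda>c. [:c:]) p) (- [:0, 1:]) *
        pcompose (map_poly (\<lambda>c. [:c:]) q) [:[:0, 1:], 1:])"
  (is "_ = map_poly _ (?P p * ?Q q)")
proof -
  let ?z = "bracket x y"
  have scl: "lift2 (smult [:c:] P) z = map_poly (map_poly (scale c)) (lift2 P z)" for c P z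
    by (auto intro!: poly_eqI simp: lift2_def coeff_map_poly tensor_def)
  have pC: "pCons u v = [:u:] + pCons 0 v" for u and v :: "'g poly" by simp
  have t0: "tensor (pCons c p) x = map_poly (scale c) [:x:] + pCons 0 (tensor p x)" for c p x
    by (simp add: tensor_simps map_poly_pCons)
  have step1: "cur_lbracket [:x:] (tensor q y) = lift2 (?Q q) ?z"
  proof (induction q)
    case 0 then show ?case by (simp add: tensor_simps lift2_simps)
  next
    case (pCons c q)
    have "?Q (pCons c q) = smult [:c:] 1 + (pCons 0 (?Q q) + smult [:0, 1:] (?Q q))"
    proof -
      have "smult [:c:] 1 = [:[:c:]:]" by (simp add: one_pCons)
      then show ?thesis by (simp add: map_poly_pCons pcompose_pCons algebra_simps)
    qed
    moreover have "lift2 1 ?z = cur_lbracket [:x:] [:y:]"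
      by (simp add: cur_lbracket_const lift2_def tensor_def map_poly_pCons one_pCons)
    ultimately show ?case
      by (simp only: t0 lift2_simps scl cur_lbracket_add_right cur_lbracket_scale_right
          cur_lbracket_deriv_right pCons.IH)
  qed
  have "cur_lbracket (tensor p x) (tensor q y) = lift2 (?P p * ?Q q) ?z"
  proof (induction p)
    case 0 then show ?case by (simp add: tensor_simps lift2_simps)
  next
    case (pCons c p)
    have "?P (pCons c p) * ?Q q = smult [:c:] (?Q q) + (- pCons 0 (?P p * ?Q q))"
      by (simp add: map_poly_pCons pcompose_pCons algebra_simps)
    then show ?case
      by (simp only: t0 lift2_simps scl cur_lbracket_add_left cur_lbracket_scale_left
          cur_lbracket_deriv_left pCons.IH step1)
  qed
  then show ?thesis by (simp add: lift2_def)
qed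

lemma cur_extension_tensor:
  assumes "Vector_Spaces.linear scale scale P"
  shows "cur_extension P (tensor p x) = tensor p (P x)"
proof -
  interpret P: Vector_Spaces.linear scale scale P by fact
  show ?thesis
    by (intro poly_eqI) (simp add: cur_extension_def tensor_def coeff_map_poly P.scale)
qed

lemma cur_poly_induct [case_names add deriv const]:
  assumes "\<And>a b. Q a \<Longrightarrow> Q b \<Longrightarrow> Q (a + b)" "\<And>a. Q a \<Longrightarrow> Q (pCons 0 a)" "\<And>x. Q [:x:]"
  shows "Q (a :: 'g poly)"
proof (induction a)
  case 0 show ?case using assms(3)[of 0] by simp
next
  case (pCons x a)
  have "pCons x a = [:x:] + pCons 0 a" by simp
  then show ?case using assms pCons by metis
qed

lemma cur_lbracket_skew: "cur_lbracket a b = - subst_skew (pCons 0) (cur_lbracket b a)"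
proof (induction a rule: cur_poly_induct)
  case (add a a')
  then show ?case by (simp add: cur_lbracket_add_left cur_lbracket_add_right subst_skew_add)
next
  case (deriv a)
  then show ?case
    by (simp add: cur_lbracket_deriv_left cur_lbracket_deriv_right subst_skew_add subst_skew_map)
next
  case (const x)
  show ?case
  proof (induction b rule: cur_poly_induct)
    case (add a a')
    then show ?case by (simp add: cur_lbracket_add_left cur_lbracket_add_right subst_skew_add)
  next
    case (deriv a)
    have "map_poly (pCons 0) (- u) = - map_poly (pCons 0) u" for u :: "'g poly poly"
      by (intro poly_eqI) (simp add: coeff_map_poly)
    then show ?case
      by (simp add: cur_lbracket_deriv_left cur_lbracket_deriv_right subst_skew_uminus deriv.IH)
  next
    case (const y)
    show ?case by (simp add: cur_lbracket_const bracket_swap[of x y])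
  qed
qed

definition cur_jac :: "'g poly \<Rightarrow> 'g poly \<Rightarrow> 'g poly \<Rightarrow> nat \<Rightarrow> nat \<Rightarrow> 'g poly" where
  "cur_jac a b c m n =
     coeff (cur_lbracket a (coeff (cur_lbracket b c) n)) m - coeff (cur_lbracket b (coeff (cur_lbracket a c) m)) n"

definition cur_jac' :: "'g poly \<Rightarrow> 'g poly \<Rightarrow> 'g poly \<Rightarrow> nat \<Rightarrow> nat \<Rightarrow> 'g poly" where
  "cur_jac' a b c m n = (\<Sum>k\<le>m. cur_scale (of_nat ((m - k + n) choose n))
                 (coeff (cur_lbracket (coeff (cur_lbracket a b) k) c) (m - k + n)))"

lemma cur_jac_add:
  "cur_jac (a + a') b c m n = cur_jac a b c m n + cur_jac a' b c m n"
  "cur_jac a (b + b') c m n = cur_jac a b c m n + cur_jac a b' c m n"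
  "cur_jac a b (c + c') m n = cur_jac a b c m n + cur_jac a b c' m n"
  "cur_jac' (a + a') b c m n = cur_jac' a b c m n + cur_jac' a' b c m n"
  "cur_jac' a (b + b') c m n = cur_jac' a b c m n + cur_jac' a b' c m n"
  "cur_jac' a b (c + c') m n = cur_jac' a b c m n + cur_jac' a b c' m n"
  by (simp_all add: cur_jac_def cur_jac'_def cur_lbracket_add_left cur_lbracket_add_right
      cur_scale_add_right sum.distrib)

abbreviation (input) sh :: "(nat \<Rightarrow> 'b::zero) \<Rightarrow> nat \<Rightarrow> 'b" where
  "sh f n \<equiv> (case n of 0 \<Rightarrow> 0 | Suc k \<Rightarrow> f k)"

lemma cur_scale_uminus: "cur_scale p (- u) = - cur_scale p u" "cur_scale p 0 = 0"
proof -
  interpret m: module cur_scale by (rule module_cur_scale)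
  show "cur_scale p (- u) = - cur_scale p u" "cur_scale p 0 = 0" by simp_all
qed

lemma cur_jac_deriv1:
  "cur_jac (pCons 0 a) b c m n = - sh (\<lambda>k. cur_jac a b c k n) m"
  "cur_jac' (pCons 0 a) b c m n = - sh (\<lambda>k. cur_jac' a b c k n) m"
proof -
  show "cur_jac (pCons 0 a) b c m n = - sh (\<lambda>k. cur_jac a b c k n) m"
    by (cases m) (simp_all add: cur_jac_def cur_lbracket_deriv_left cur_lbracket_minus)
  show "cur_jac' (pCons 0 a) b c m n = - sh (\<lambda>k. cur_jac' a b c k n) m"
    by (cases m) (simp_all add: cur_jac'_def cur_lbracket_deriv_left cur_lbracket_minus
        cur_scale_uminus sum.atMost_Suc_shift sum_negf del: sum.atMost_Suc)
qed

lemma cur_jac_deriv2: "cur_jac a (pCons 0 b) c m n = - sh (\<lambda>k. cur_jac a b c m k) n"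
  by (cases n) (simp_all add: cur_jac_def cur_lbracket_deriv_left cur_lbracket_minus)

lemma cur_jac_deriv3:
  "cur_jac a b (pCons 0 c) m n =
     sh (\<lambda>k. cur_jac a b c m k) n + sh (\<lambda>k. cur_jac a b c k n) m + pCons 0 (cur_jac a b c m n)"
  by (cases n; cases m) (simp_all add: cur_jac_def cur_lbracket_deriv_right coeff_map_poly
      cur_lbracket_add_right)

lemma cur_scale_of_nat_add:
  "cur_scale (of_nat (i + j)) u = cur_scale (of_nat i) u + cur_scale (of_nat j) u"
  by (simp add: cur_scale_add_left)

lemma binomial_sum_shift:
  fixes D :: "nat \<Rightarrow> nat \<Rightarrow> 'g poly"
  shows "(\<Sum>k\<le>m. cur_scale (of_nat ((m - k + n) choose n)) (sh (D k) (m - k + n))) =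
    sh (\<lambda>n'. \<Sum>k\<le>m. cur_scale (of_nat ((m - k + n') choose n')) (D k (m - k + n'))) n +
    sh (\<lambda>m'. \<Sum>k\<le>m'. cur_scale (of_nat ((m' - k + n) choose n)) (D k (m' - k + n))) m"
proof (cases m)
  case 0
  then show ?thesis by (cases n) (simp_all add: cur_scale_uminus)
next
  case (Suc m')
  have top: "(\<Sum>k\<le>Suc m'. f k) = (\<Sum>k\<le>m'. f k) + f (Suc m')" for f :: "nat \<Rightarrow> 'g poly" by simp
  show ?thesis
  proof (cases n)
    case 0
    have "Suc m' - k = Suc (m' - k)" if "k \<le> m'" for k using that by simp
    then show ?thesis using Suc 0 by (simp add: cur_scale_uminus)
  next
    case (Suc n')
    have "cur_scale (of_nat ((Suc m' - k + Suc n') choose Suc n')) (sh (D k) (Suc m' - k + Suc n')) =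
      cur_scale (of_nat ((Suc m' - k + n') choose n')) (D k (Suc m' - k + n')) +
      cur_scale (of_nat ((m' - k + Suc n') choose Suc n')) (D k (m' - k + Suc n'))" if "k \<le> m'" for k
    proof -
      have e: "Suc m' - k = Suc (m' - k)" using that by simp
      show ?thesis unfolding e by (simp add: cur_scale_add_left)
    qed
    then have "(\<Sum>k\<le>m'. cur_scale (of_nat ((Suc m' - k + Suc n') choose Suc n')) (sh (D k) (Suc m' - k + Suc n'))) =
      (\<Sum>k\<le>m'. cur_scale (of_nat ((Suc m' - k + n') choose n')) (D k (Suc m' - k + n'))) +
      (\<Sum>k\<le>m'. cur_scale (of_nat ((m' - k + Suc n') choose Suc n')) (D k (m' - k + Suc n')))"
      by (simp only: sum.distrib[symmetric] cong: sum.cong) (rule sum.cong, simp_all)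
    then show ?thesis unfolding \<open>m = Suc m'\<close> Suc top by simp
  qed
qed

lemma cur_jac'_deriv2: "cur_jac' a (pCons 0 b) c m n = - sh (\<lambda>k. cur_jac' a b c m k) n"
proof -
  define D where "D k = coeff (cur_lbracket (coeff (cur_lbracket a b) k) c)" for k
  have D': "coeff (cur_lbracket (coeff (cur_lbracket a (pCons 0 b)) k) c) j =
      sh (\<lambda>k'. D k' j) k - sh (D k) j" for k j
    by (cases k; cases j) (simp_all add: D_def cur_lbracket_deriv_right coeff_map_poly
        cur_lbracket_add_left cur_lbracket_deriv_left)
  have dd: "cur_scale p (u - v) = cur_scale p u - cur_scale p v" for p u v
    using cur_scale_add_right[of p u "- v"] by (simp add: cur_scale_uminus)
  have "cur_jac' a (pCons 0 b) c m n =
    (\<Sum>k\<le>m. cur_scale (of_nat ((m - k + n) choose n)) (sh (\<lambda>k'. D k' (m - k + n)) k)) -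
    (\<Sum>k\<le>m. cur_scale (of_nat ((m - k + n) choose n)) (sh (D k) (m - k + n)))"
    unfolding sum_subtractf[symmetric] cur_jac'_def D' dd ..
  also have "(\<Sum>k\<le>m. cur_scale (of_nat ((m - k + n) choose n)) (sh (\<lambda>k'. D k' (m - k + n)) k)) =
    sh (\<lambda>m'. \<Sum>k\<le>m'. cur_scale (of_nat ((m' - k + n) choose n)) (D k (m' - k + n))) m"
    by (cases m) (simp_all add: cur_scale_uminus sum.atMost_Suc_shift del: sum.atMost_Suc)
  finally show ?thesis
    unfolding binomial_sum_shift unfolding cur_jac'_def D_def by simp
qed

lemma cur_jac'_deriv3:
  "cur_jac' a b (pCons 0 c) m n =
     sh (\<lambda>k. cur_jac' a b c m k) n + sh (\<lambda>k. cur_jac' a b c k n) m + pCons 0 (cur_jac' a b c m n)"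
proof -
  define D where "D k = coeff (cur_lbracket (coeff (cur_lbracket a b) k) c)" for k
  have pCs: "(\<Sum>k\<in>A. pCons 0 (f k)) = pCons 0 (\<Sum>k\<in>A. f k)" for f :: "nat \<Rightarrow> 'g poly" and A
    by (induction A rule: infinite_finite_induct) auto
  have "cur_jac' a b (pCons 0 c) m n =
    (\<Sum>k\<le>m. cur_scale (of_nat ((m - k + n) choose n)) (sh (D k) (m - k + n))) +
    pCons 0 (\<Sum>k\<le>m. cur_scale (of_nat ((m - k + n) choose n)) (D k (m - k + n)))"
    unfolding pCs[symmetric] sum.distrib[symmetric] cur_jac'_def D_def
    by (rule sum.cong)
      (simp_all add: cur_lbracket_deriv_right coeff_map_poly coeff_pCons
        cur_scale_add_right cur_scale_pCons_0)
  then show ?thesis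
    unfolding binomial_sum_shift unfolding cur_jac'_def D_def by simp
qed

lemma cur_lbracket_jacobi: "cur_jac a b c m n = cur_jac' a b c m n"
proof (induction a arbitrary: m n rule: cur_poly_induct)
  case (const x)
  show ?case
  proof (induction b arbitrary: m n rule: cur_poly_induct)
    case (const y)
    show ?case
    proof (induction c arbitrary: m n rule: cur_poly_induct)
      case (const z)
      have "bracket x (bracket y z) - bracket y (bracket x z) = bracket (bracket x y) z"
      proof -
        have "bracket y (bracket z x) = - bracket y (bracket x z)"
          by (simp add: bracket_swap[of z x] bracket_minus)
        moreover have "bracket z (bracket x y) = - bracket (bracket x y) z"
          by (rule bracket_swap)
        ultimately show ?thesis using jacobi[of x y z] by simp
      qed
      moreover have "cur_jac' [:x:] [:y:] [:z:] m n =
        (if m = 0 \<and> n = 0 then [:bracket (bracket x y) z:] else 0)"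
      proof -
        have "cur_jac' [:x:] [:y:] [:z:] m n = (\<Sum>k\<le>m. if k = 0 \<and> m = 0 \<and> n = 0
           then [:bracket (bracket x y) z:] else 0)"
          unfolding cur_jac'_def
          by (rule sum.cong) (auto simp: cur_lbracket_const coeff_pCons one_pCons
              map_poly_scale_add cur_scale_uminus split: nat.splits)
        then show ?thesis by auto
      qed
      ultimately show ?case
        by (auto simp: cur_jac_def cur_lbracket_const coeff_pCons split: nat.splits)
    qed (simp_all add: cur_jac_add cur_jac_deriv3 cur_jac'_deriv3 split: nat.splits)
  qed (simp_all add: cur_jac_add cur_jac_deriv2 cur_jac'_deriv2 split: nat.splits)
qed (simp_all add: cur_jac_add cur_jac_deriv1 split: nat.splits)

sublocale cur: lie_conformal_algebra cur_scale cur_lbracket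
proof -
  interpret m: module cur_scale by (rule module_cur_scale)
  show "lie_conformal_algebra cur_scale cur_lbracket"
    by unfold_locales
      (simp_all only: cur_lbracket_add_left cur_lbracket_add_right cur_scale_const cur_scale_deriv
        cur_lbracket_scale_left cur_lbracket_scale_right cur_lbracket_deriv_left
        cur_lbracket_deriv_right cur_lbracket_skew[symmetric]
        cur_lbracket_jacobi[unfolded cur_jac_def cur_jac'_def])
qed

end


section \<open>The Lie algebra of traceless 2x2 complex matrices\<close>

lemma matrix_distrib:
  fixes A B C :: "'a::comm_ring_1^'n^'n"
  shows "A ** (B - C) = A ** B - A ** C" "(B - C) ** A = B ** A - C ** A"
    "A ** (B + C) = A ** B + A ** C" "(B + C) ** A = B ** A + C ** A"
  by (simp_all add: matrix_matrix_mult_def vec_eq_iff algebra_simps sum_subtractf sum.distrib)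

typedef sl2 = "{A :: complex^2^2. trace A = 0}"
  by (rule exI[of _ 0]) (simp add: trace_def)

setup_lifting type_definition_sl2

instantiation sl2 :: ab_group_add
begin

lift_definition zero_sl2 :: sl2 is 0 by (simp add: trace_def)
lift_definition plus_sl2 :: "sl2 \<Rightarrow> sl2 \<Rightarrow> sl2" is "(+)" by (simp add: trace_add)
lift_definition minus_sl2 :: "sl2 \<Rightarrow> sl2 \<Rightarrow> sl2" is "(-)" by (simp add: trace_sub)
lift_definition uminus_sl2 :: "sl2 \<Rightarrow> sl2" is uminus by (simp add: trace_def sum_negf)

instance
proof
  fix a b c :: sl2
  show "a + b + c = a + (b + c)" by transfer (rule add.assoc)
  show "a + b = b + a" by transfer (rule add.commute)
  show "0 + a = a" by transfer simp
  show "- a + a = 0" by transfer simp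
  show "a - b = a + - b" by transfer simp
qed

end

lift_definition sl2_scale :: "complex \<Rightarrow> sl2 \<Rightarrow> sl2" is "\<lambda>c A. \<chi> i j. c * A $ i $ j"
  by (simp add: trace_def sum_distrib_left[symmetric])

lift_definition sl2_bracket :: "sl2 \<Rightarrow> sl2 \<Rightarrow> sl2" is "\<lambda>A B. A ** B - B ** A"
  by (simp add: trace_sub) (rule trace_mul_sym)

lift_definition sl2_e :: sl2 is "vector [vector [0, 1], vector [0, 0]]"
  by (simp add: trace_def sum_2)

lift_definition sl2_f :: sl2 is "vector [vector [0, 0], vector [1, 0]]"
  by (simp add: trace_def sum_2)

lift_definition sl2_h :: sl2 is "vector [vector [1, 0], vector [0, -1]]"
  by (simp add: trace_def sum_2)

global_interpretation sl2: lie_algebra sl2_scale sl2_bracket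
proof
  fix a b :: complex and x y z :: sl2
  show "sl2_scale a (x + y) = sl2_scale a x + sl2_scale a y"
    by transfer (simp add: vec_eq_iff algebra_simps)
  show "sl2_scale (a + b) x = sl2_scale a x + sl2_scale b x"
    by transfer (simp add: vec_eq_iff algebra_simps)
  show "sl2_scale a (sl2_scale b x) = sl2_scale (a * b) x"
    by transfer (simp add: vec_eq_iff)
  show "sl2_scale 1 x = x"
    by transfer (simp add: vec_eq_iff)
  show "sl2_bracket (x + y) z = sl2_bracket x z + sl2_bracket y z"
    by transfer (simp add: matrix_distrib)
  show "sl2_bracket x (y + z) = sl2_bracket x y + sl2_bracket x z"
    by transfer (simp add: matrix_distrib)
  show "sl2_bracket (sl2_scale a x) y = sl2_scale a (sl2_bracket x y)"
    by transfer (simp add: vec_eq_iff matrix_matrix_mult_def sum_distrib_left algebra_simps)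
  show "sl2_bracket x (sl2_scale a y) = sl2_scale a (sl2_bracket x y)"
    by transfer (simp add: vec_eq_iff matrix_matrix_mult_def sum_distrib_left algebra_simps)
  show "sl2_bracket x x = 0"
    by transfer simp
  show "sl2_bracket x (sl2_bracket y z) + sl2_bracket y (sl2_bracket z x) +
        sl2_bracket z (sl2_bracket x y) = 0"
    by transfer (simp add: matrix_distrib matrix_mul_assoc)
qed

lemma sl2_bracket_basis:
  "sl2_bracket sl2_e sl2_f = sl2_h"
  "sl2_bracket sl2_h sl2_e = sl2_scale 2 sl2_e"
  "sl2_bracket sl2_h sl2_f = sl2_scale (-2) sl2_f"
  by (transfer, simp add: vec_eq_iff matrix_matrix_mult_def sum_2 forall_2)+

lemma sl2_span: "\<exists>a b c. x = sl2_scale a sl2_e + sl2_scale b sl2_f + sl2_scale c sl2_h"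
proof -
  define A where "A = Rep_sl2 x"
  have "A $ 2 $ 2 = - A $ 1 $ 1"
    using Rep_sl2[of x] by (simp add: A_def trace_def sum_2 eq_neg_iff_add_eq_0 add.commute)
  then have "x = sl2_scale (A $ 1 $ 2) sl2_e + sl2_scale (A $ 2 $ 1) sl2_f + sl2_scale (A $ 1 $ 1) sl2_h"
    by (simp add: Rep_sl2_inject[symmetric] plus_sl2.rep_eq sl2_scale.rep_eq sl2_e.rep_eq
        sl2_f.rep_eq sl2_h.rep_eq A_def[symmetric] vec_eq_iff forall_2)
  then show ?thesis by blast
qed

lemma sl2_indep:
  assumes "sl2_scale a sl2_e + sl2_scale b sl2_f + sl2_scale c sl2_h = 0"
  shows "a = 0 \<and> b = 0 \<and> c = 0"
  using assms
  by (simp add: Rep_sl2_inject[symmetric] plus_sl2.rep_eq zero_sl2.rep_eq sl2_scale.rep_eq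
      sl2_e.rep_eq sl2_f.rep_eq sl2_h.rep_eq vec_eq_iff forall_2)

end

theory Submission
  imports Defs
begin

text \<open>
  Write \<open>R x = \<Sum>\<^sub>i \<partial>\<^sup>i A\<^sub>i x\<close> for \<open>x\<close> in the Lie algebra, and \<open>A(s) = \<Sum>\<^sub>i s\<^sup>i A\<^sub>i\<close>. Substituting
  \<open>\<lambda> = -s\<close> and \<open>\<partial> = s + t\<close>, the Rota--Baxter identity becomes
  \<open>[A(s)x, A(t)y] = A(s+t)([A(s)x, y] + [x, A(t)y] + [x, y])\<close>. It is tested below only to first order
  in \<open>\<lambda>\<close>, that is, through its coefficients of \<open>\<lambda>\<^sup>0\<close> and \<open>\<lambda>\<^sup>1\<close>; these are two families of bilinear
  identities between the maps \<open>A\<^sub>i\<close> (\<open>rota_baxter_components\<close>).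

  If \<open>A\<^sub>i = 0\<close> for all \<open>i > 0\<close>, then \<open>R\<close> is the extension of \<open>A\<^sub>0\<close>, and \<open>A\<^sub>0\<close> is a Rota--Baxter operator.
  Otherwise let \<open>n > 0\<close> be the largest index with \<open>A\<^sub>n \<noteq> 0\<close>. The coefficient of degree \<open>2n\<close> says
  \<open>A\<^sub>n[x, A\<^sub>n y] = 0\<close>. Since two independent vectors \<open>v, w\<close> of \<open>sl\<^sub>2\<close> satisfy \<open>[sl\<^sub>2, v] + [sl\<^sub>2, w] = sl\<^sub>2\<close>,
  this forces \<open>A\<^sub>n\<close> to have a one-dimensional image \<open>\<complex>v\<close> and to vanish on the plane \<open>[sl\<^sub>2, v]\<close>.
  A constant automorphism moves \<open>v\<close> to a multiple of \<open>h\<close> or of \<open>e\<close>, according to whether \<open>v\<close> is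
  semisimple or nilpotent (\<open>sl2_normal_form\<close>).

  In both cases the coefficients of degree between \<open>n\<close> and \<open>2n\<close> propagate this shape downwards from
  \<open>A\<^sub>n\<close> to the maps \<open>A\<^sub>k\<close> with \<open>0 < k < n\<close> (\<open>higher_components\<close> for \<open>k \<ge> 2\<close>), with
  one harmless exception for nilpotent \<open>v\<close>. The coefficient of degree \<open>n\<close>, where \<open>A\<^sub>0\<close> meets \<open>A\<^sub>n\<close>,
  then determines \<open>A\<^sub>0\<close> up to few parameters.

  For semisimple \<open>v\<close> (\<open>semisimple_top\<close>) all \<open>A\<^sub>k\<close> with \<open>k > 0\<close> map \<open>h\<close> to a multiple of \<open>h\<close> and kill \<open>e\<close>
  and \<open>f\<close>, while \<open>A\<^sub>0\<close> is diagonal with eigenvalues \<open>-1\<close> and \<open>0\<close> on \<open>e\<close> and \<open>f\<close>, in some order. This is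
  the operator (Q1), after exchanging \<open>e\<close> and \<open>f\<close> if necessary. For nilpotent \<open>v\<close> (\<open>nilpotent_top\<close>) one
  finds \<open>A\<^sub>0 e = -e/2\<close> and \<open>A\<^sub>0 h = -h/2 + p e\<close>, which contradicts the Rota--Baxter identity of \<open>A\<^sub>0\<close> on the
  pair \<open>e, h\<close>.
\<close>

section \<open>Components of a linear operator on a current algebra\<close>

context lie_algebra
begin

definition component :: "('g poly \<Rightarrow> 'g poly) \<Rightarrow> nat \<Rightarrow> 'g \<Rightarrow> 'g" where
  "component R i x = coeff (R [:x:]) i"

lemma linear_component:
  assumes "module_hom cur_scale cur_scale R"
  shows "Vector_Spaces.linear scale scale (component R i)"
proof -
  interpret R: module_hom cur_scale cur_scale R by fact
  show ?thesis
  proof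
    fix x y :: 'g and c
    have "[:x + y:] = [:x:] + [:y:]" by simp
    then show "component R i (x + y) = component R i x + component R i y"
      by (simp only: component_def R.add coeff_add)
    have "[:c \<cdot> x:] = cur_scale [:c:] [:x:]"
      by (simp add: map_poly_pCons)
    then have "R [:c \<cdot> x:] = cur_scale [:c:] (R [:x:])"
      by (metis R.scale)
    then show "component R i (c \<cdot> x) = c \<cdot> component R i x"
      by (simp add: component_def coeff_map_poly)
  qed
qed

text \<open>
  By \<open>\<complex>[\<partial>]\<close>-linearity the components \<open>A\<^sub>i\<close> determine \<open>R\<close>: the image of \<open>\<Sum> \<partial>\<^sup>j u\<^sub>j\<close> is the Cauchy
  product \<open>\<Sum> \<partial>\<^sup>i\<^sup>+\<^sup>j A\<^sub>i u\<^sub>j\<close>.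
\<close>

lemma coeff_cur_hom:
  assumes "module_hom cur_scale cur_scale R"
  shows "coeff (R u) m = (\<Sum>i\<le>m. component R i (coeff u (m - i)))"
proof -
  interpret R: module_hom cur_scale cur_scale R by fact
  have zero: "component R i 0 = 0" for i
    using R.zero by (simp add: component_def)
  show ?thesis
  proof (induction u arbitrary: m)
    case 0
    show ?case by (simp add: R.zero zero)
  next
    case (pCons x u)
    have "pCons x u = [:x:] + cur_scale [:0, 1:] u"
      unfolding cur_scale_deriv by simp
    then have "R (pCons x u) = R [:x:] + cur_scale [:0, 1:] (R u)"
      by (metis R.add R.scale)
    then have R: "R (pCons x u) = R [:x:] + pCons 0 (R u)"
      unfolding cur_scale_deriv .
    show ?case
    proof (cases m)
      case 0
      then show ?thesis by (simp add: R component_def)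
    next
      case (Suc l)
      have "(\<Sum>i\<le>l. component R i (coeff (pCons x u) (Suc l - i))) =
          (\<Sum>i\<le>l. component R i (coeff u (l - i)))"
        by (intro sum.cong) (simp_all add: Suc_diff_le)
      then show ?thesis
        using Suc by (simp add: R pCons.IH component_def add.commute)
    qed
  qed
qed

lemma cur_lbracket_const_pCons:
  "cur_lbracket [:x:] (pCons y b) = [:[:bracket x y:]:] +
     (pCons 0 (cur_lbracket [:x:] b) + map_poly (pCons 0) (cur_lbracket [:x:] b))"
proof -
  have "pCons y b = [:y:] + pCons 0 b" by simp
  then show ?thesis
    by (simp only: cur_lbracket_add_right cur_lbracket_const cur_lbracket_deriv_right)
qed

lemma cur_lbracket_const_coeff_0:
  "coeff (coeff (cur_lbracket [:x:] b) 0) j = bracket x (coeff b j)"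
proof (induction b arbitrary: j)
  case (pCons y b)
  show ?case
    by (cases j) (simp_all add: cur_lbracket_const_pCons coeff_map_poly pCons.IH)
qed simp

lemma cur_lbracket_const_coeff_1:
  "coeff (coeff (cur_lbracket [:x:] b) 1) j = of_nat (j + 1) \<cdot> bracket x (coeff b (j + 1))"
proof (induction b arbitrary: j)
  case (pCons y b)
  have double: "2 \<cdot> z = z + z" for z
    by (metis one_add_one scale_left_distrib scale_one)
  show ?case
    using pCons.IH by (cases j) (simp_all add: cur_lbracket_const_pCons cur_lbracket_const_coeff_0
        coeff_map_poly scale_left_distrib double)
qed simp

text \<open>
  Expansion of \<open>(-\<lambda>)\<^sup>i (\<lambda>+\<partial>)\<^sup>j\<close> to first order in \<open>\<lambda>\<close>: only \<open>i \<le> 1\<close> contributes, \<open>i = 0\<close> with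
  \<open>\<partial>\<^sup>j + j \<lambda> \<partial>\<^sup>j\<^sup>-\<^sup>1\<close> and \<open>i = 1\<close> with \<open>-\<lambda> \<partial>\<^sup>j\<close>.
\<close>

lemma cur_lbracket_coeffs:
  "coeff (coeff (cur_lbracket a b) 0) j = bracket (coeff a 0) (coeff b j)"
  "coeff (coeff (cur_lbracket a b) 1) j =
     of_nat (j + 1) \<cdot> bracket (coeff a 0) (coeff b (j + 1)) - bracket (coeff a 1) (coeff b j)"
proof -
  obtain x a' where a: "a = pCons x a'" by (cases a)
  have split: "pCons z c = [:z:] + pCons 0 c" for z :: 'g and c by simp
  have L: "cur_lbracket (pCons z c) b = cur_lbracket [:z:] b - pCons 0 (cur_lbracket c b)" for z c
    by (subst split) (simp only: cur_lbracket_add_left cur_lbracket_deriv_left diff_conv_add_uminus)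
  obtain y a'' where a': "a' = pCons y a''" by (cases a')
  show 0: "coeff (coeff (cur_lbracket a b) 0) j = bracket (coeff a 0) (coeff b j)"
    unfolding a L[of x a'] by (simp add: cur_lbracket_const_coeff_0)
  have "coeff (coeff (cur_lbracket a b) 1) j =
    coeff (coeff (cur_lbracket [:x:] b) 1) j - coeff (coeff (cur_lbracket [:y:] b) 0) j"
    unfolding a L[of x a'] unfolding a' L[of y a''] by simp
  then show "coeff (coeff (cur_lbracket a b) 1) j =
     of_nat (j + 1) \<cdot> bracket (coeff a 0) (coeff b (j + 1)) - bracket (coeff a 1) (coeff b j)"
    by (simp only: cur_lbracket_const_coeff_0 cur_lbracket_const_coeff_1) (simp add: a a')
qed

text \<open>
  These are the coefficients of \<open>\<lambda>\<^sup>0 \<partial>\<^sup>m\<close> and \<open>\<lambda>\<^sup>1 \<partial>\<^sup>m\<close> in the Rota--Baxter identity for two elements \<open>x, y\<close>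
  of the Lie algebra. The term \<open>[x\<^sub>\<lambda> y]\<close> is constant in \<open>\<lambda>\<close>, so the weight enters only the first family.
  The right sides contain convolutions of components, the left sides only single brackets that vanish
  for \<open>m\<close> beyond the degree of \<open>R\<close>; this is what makes the identities useful.
\<close>

lemma rota_baxter_components:
  assumes "cur.rota_baxter k R"
  shows "bracket (component R 0 x) (component R m y) =
      component R m (bracket (component R 0 x + k \<cdot> x) y) +
      (\<Sum>i\<le>m. component R i (bracket x (component R (m - i) y)))"
    and "of_nat (m + 1) \<cdot> bracket (component R 0 x) (component R (m + 1) y) -
      bracket (component R 1 x) (component R m y) =
      (\<Sum>i\<le>m. component R i (of_nat (m - i + 1) \<cdot> bracket x (component R (m - i + 1) y))) -
      component R m (bracket (component R 1 x) y)"
proof -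
  have hom: "module_hom cur_scale cur_scale R"
    and rb: "cur_lbracket (R [:x:]) (R [:y:]) = map_poly R (cur_lbracket (R [:x:]) [:y:] +
      cur_lbracket [:x:] (R [:y:]) + map_poly (cur_scale [:k:]) (cur_lbracket [:x:] [:y:]))"
    using assms by (auto simp: cur.rota_baxter_def)
  interpret R: module_hom cur_scale cur_scale R by fact
  interpret A: Vector_Spaces.linear scale scale "component R i" for i
    using hom by (rule linear_component)
  \<comment> \<open>The argument of \<open>R\<close> on the right side of the identity, in degree \<open>p\<close> of \<open>\<lambda>\<close>.\<close>
  define u where "u p = coeff (cur_lbracket (R [:x:]) [:y:]) p + coeff (cur_lbracket [:x:] (R [:y:])) p
      + cur_scale [:k:] (coeff (cur_lbracket [:x:] [:y:]) p)" for p
  have coeffs: "coeff (cur_lbracket (R [:x:]) (R [:y:])) p = R (u p)" for p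
    unfolding rb u_def by (simp add: coeff_map_poly R.zero)
  have coeff_scale: "coeff (map_poly (scale c) w) j = c \<cdot> coeff w j" for c w j
    by (simp add: coeff_map_poly)
  have u0: "coeff (u 0) j = (if j = 0 then bracket (component R 0 x + k \<cdot> x) y else 0) +
      bracket x (component R j y)" for j
    unfolding u_def coeff_add cur_scale_const coeff_scale cur_lbracket_coeffs
    by (cases j) (simp_all add: component_def bracket_add_left bracket_scale_left)
  have u1: "coeff (u 1) j = of_nat (j + 1) \<cdot> bracket x (component R (j + 1) y) -
      (if j = 0 then bracket (component R 1 x) y else 0)" for j
    unfolding u_def coeff_add cur_scale_const coeff_scale cur_lbracket_coeffs
    by (cases j) (simp_all add: component_def)
  have single: "(\<Sum>i\<le>m. component R i (if m - i = 0 then z else 0)) = component R m z" for z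
  proof -
    have "(\<Sum>i\<le>m. component R i (if m - i = 0 then z else 0)) =
        (\<Sum>i\<le>m. if i = m then component R i z else 0)"
      by (intro sum.cong) (auto simp: A.zero)
    then show ?thesis by simp
  qed
  show "bracket (component R 0 x) (component R m y) =
      component R m (bracket (component R 0 x + k \<cdot> x) y) +
      (\<Sum>i\<le>m. component R i (bracket x (component R (m - i) y)))"
    using arg_cong[OF coeffs[of 0], of "\<lambda>p. coeff p m"]
    unfolding cur_lbracket_coeffs coeff_cur_hom[OF hom, of "u 0"] u0 A.add sum.distrib single
    by (simp add: component_def)
  show "of_nat (m + 1) \<cdot> bracket (component R 0 x) (component R (m + 1) y) -
      bracket (component R 1 x) (component R m y) =
      (\<Sum>i\<le>m. component R i (of_nat (m - i + 1) \<cdot> bracket x (component R (m - i + 1) y))) -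
      component R m (bracket (component R 1 x) y)"
    using arg_cong[OF coeffs[of 1], of "\<lambda>p. coeff p m"]
    unfolding cur_lbracket_coeffs coeff_cur_hom[OF hom, of "u 1"] u1 A.diff sum_subtractf single
    by (simp add: component_def)
qed

end

section \<open>Conjugation by constant automorphisms\<close>

context lie_algebra
begin

definition lie_automorphism :: "('g \<Rightarrow> 'g) \<Rightarrow> bool" where
  "lie_automorphism \<phi> \<longleftrightarrow> bij \<phi> \<and> Vector_Spaces.linear scale scale \<phi> \<and>
     (\<forall>x y. bracket (\<phi> x) (\<phi> y) = \<phi> (bracket x y))"

lemma lie_automorphism_comp:
  assumes "lie_automorphism \<phi>" "lie_automorphism \<psi>"
  shows "lie_automorphism (\<phi> \<circ> \<psi>)"
  using assms by (auto simp: lie_automorphism_def bij_comp intro: Vector_Spaces.linear_compose)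

lemma module_hom_cur_extension:
  assumes "Vector_Spaces.linear scale scale \<phi>"
  shows "module_hom cur_scale cur_scale (cur_extension \<phi>)"
proof -
  interpret P: Vector_Spaces.linear scale scale \<phi> by fact
  interpret m: module cur_scale by (rule module_cur_scale)
  have add: "map_poly \<phi> (u + v) = map_poly \<phi> u + map_poly \<phi> v" for u v
    by (rule map_poly_add') (simp_all add: P.zero P.add)
  have scale: "map_poly \<phi> (map_poly (scale c) u) = map_poly (scale c) (map_poly \<phi> u)" for c u
    by (intro poly_eqI) (simp add: coeff_map_poly P.zero P.scale)
  show ?thesis
  proof
    fix p u v
    show "cur_extension \<phi> (u + v) = cur_extension \<phi> u + cur_extension \<phi> v"
      by (simp add: cur_extension_def add)
    show "cur_extension \<phi> (cur_scale p u) = cur_scale p (cur_extension \<phi> u)"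
      unfolding cur_extension_def
      by (induction p) (simp_all add: add scale map_poly_pCons P.zero)
  qed
qed

text \<open>
  The bracket of \<open>Cur \<gg>\<close> is built from that of \<open>\<gg>\<close> by operations acting on the powers of \<open>\<partial>\<close> and \<open>\<lambda>\<close>
  alone, so an automorphism of \<open>\<gg>\<close> applied to all coefficients preserves it. These constant
  automorphisms suffice for the classification.
\<close>

lemma automorphism_cur_extension:
  assumes "lie_automorphism \<phi>"
  shows "cur.automorphism (cur_extension \<phi>)"
    and "inv (cur_extension \<phi>) = cur_extension (inv \<phi>)"
proof -
  have bij: "bij \<phi>" and lin: "Vector_Spaces.linear scale scale \<phi>"
    and br: "\<And>x y. bracket (\<phi> x) (\<phi> y) = \<phi> (bracket x y)"
    using assms by (auto simp: lie_automorphism_def)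
  interpret P: Vector_Spaces.linear scale scale \<phi> by fact
  let ?\<psi> = "map_poly \<phi>"
  have inv0: "inv \<phi> 0 = 0"
    using bij P.zero by (metis bij_inv_eq_iff)
  have inv1: "map_poly (inv \<phi>) (map_poly \<phi> u) = u" for u
    by (intro poly_eqI) (simp add: coeff_map_poly inv0 P.zero bij_is_inj[OF bij])
  have inv2: "map_poly \<phi> (map_poly (inv \<phi>) u) = u" for u
    by (intro poly_eqI) (simp add: coeff_map_poly inv0 P.zero surj_f_inv_f[OF bij_is_surj[OF bij]])
  have bij': "bij (cur_extension \<phi>)"
    unfolding cur_extension_def by (rule bijI'[of "map_poly \<phi>"]) (metis inv1 inv2)+
  show "inv (cur_extension \<phi>) = cur_extension (inv \<phi>)"
    unfolding cur_extension_def by (rule inv_unique_comp) (auto simp: inv1 inv2)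
  have add: "map_poly \<phi> (u + v) = map_poly \<phi> u + map_poly \<phi> v" for u v
    by (rule map_poly_add') (simp_all add: P.zero P.add)
  have add2: "map_poly ?\<psi> (u + v) = map_poly ?\<psi> u + map_poly ?\<psi> v" for u v
    by (rule map_poly_add') (simp_all add: add)
  have minus2: "map_poly ?\<psi> (- u) = - map_poly ?\<psi> u" for u
    by (intro poly_eqI) (simp add: coeff_map_poly P.zero P.neg)
  have shift: "map_poly ?\<psi> (map_poly (pCons 0) u) = map_poly (pCons 0) (map_poly ?\<psi> u)" for u
    by (intro poly_eqI) (simp add: coeff_map_poly map_poly_pCons P.zero)
  have "cur_lbracket (?\<psi> a) (?\<psi> b) = map_poly ?\<psi> (cur_lbracket a b)" for a b
  proof (induction a rule: cur_poly_induct)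
    case (const x)
    show ?case
    proof (induction b rule: cur_poly_induct)
      case (const y)
      show ?case by (simp add: map_poly_pCons P.zero cur_lbracket_const br)
    next
      case (deriv b)
      then show ?case
        by (simp add: map_poly_pCons P.zero cur_lbracket_deriv_right add2 shift)
    qed (simp add: add add2 cur_lbracket_add_right)
  next
    case (deriv a)
    then show ?case by (simp add: map_poly_pCons P.zero cur_lbracket_deriv_left minus2)
  qed (simp add: add add2 cur_lbracket_add_left)
  then show "cur.automorphism (cur_extension \<phi>)"
    unfolding cur.automorphism_def using bij' module_hom_cur_extension[OF lin]
    by (simp add: cur_extension_def)
qed

lemma component_conj:
  assumes "lie_automorphism \<phi>"
  shows "component (inv (cur_extension \<phi>) \<circ> R \<circ> cur_extension \<phi>) i x = inv \<phi> (component R i (\<phi> x))"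
proof -
  interpret P: Vector_Spaces.linear scale scale \<phi>
    using assms by (simp add: lie_automorphism_def)
  have "\<phi> 0 = 0" and "bij \<phi>"
    using assms by (auto simp: lie_automorphism_def P.zero)
  then have "inv \<phi> 0 = 0" by (metis bij_inv_eq_iff)
  then show ?thesis
    unfolding component_def comp_apply automorphism_cur_extension(2)[OF assms]
    unfolding cur_extension_def by (simp add: map_poly_pCons coeff_map_poly \<open>\<phi> 0 = 0\<close>)
qed

end

context lie_conformal_algebra
begin

lemma rota_baxter_conj:
  assumes "automorphism \<psi>" "rota_baxter k R"
  shows "rota_baxter k (inv \<psi> \<circ> R \<circ> \<psi>)"
proof -
  have bij: "bij \<psi>" and br: "\<And>a b. lbracket (\<psi> a) (\<psi> b) = map_poly \<psi> (lbracket a b)"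
    using assms(1) by (auto simp: automorphism_def)
  interpret P: module_hom scale scale \<psi> using assms(1) by (simp add: automorphism_def)
  interpret R: module_hom scale scale R using assms(2) by (simp add: rota_baxter_def)
  have inv: "inv \<psi> (\<psi> a) = a" "\<psi> (inv \<psi> a) = a" for a
    using bij by (simp_all add: bij_is_inj bij_is_surj surj_f_inv_f)
  have inv_add: "inv \<psi> (a + b) = inv \<psi> a + inv \<psi> b" for a b
    by (metis P.add inv)
  have inv_scale: "inv \<psi> (p \<cdot> a) = p \<cdot> inv \<psi> a" for p a
    by (metis P.scale inv)
  have inv_0: "inv \<psi> 0 = 0" by (metis P.zero inv(1))
  have hom: "module_hom scale scale (inv \<psi> \<circ> R \<circ> \<psi>)"
    by unfold_locales (simp_all add: P.add R.add P.scale R.scale inv_add inv_scale)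
  have inv_br: "lbracket (inv \<psi> a) (inv \<psi> b) = map_poly (inv \<psi>) (lbracket a b)" for a b
  proof -
    have "map_poly (inv \<psi>) (map_poly \<psi> u) = u" for u
      by (intro poly_eqI) (simp add: coeff_map_poly inv inv_0 P.zero)
    then show ?thesis by (metis br inv(2))
  qed
  have "lbracket ((inv \<psi> \<circ> R \<circ> \<psi>) a) ((inv \<psi> \<circ> R \<circ> \<psi>) b) = map_poly (inv \<psi> \<circ> R \<circ> \<psi>)
      (lbracket ((inv \<psi> \<circ> R \<circ> \<psi>) a) b + lbracket a ((inv \<psi> \<circ> R \<circ> \<psi>) b) +
       map_poly (scale [:k:]) (lbracket a b))" for a b
  proof -
    have "lbracket (R (\<psi> a)) (R (\<psi> b)) = map_poly R (lbracket (R (\<psi> a)) (\<psi> b) +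
        lbracket (\<psi> a) (R (\<psi> b)) + map_poly (scale [:k:]) (lbracket (\<psi> a) (\<psi> b)))"
      using assms(2) by (simp add: rota_baxter_def)
    also have "lbracket (R (\<psi> a)) (\<psi> b) = map_poly \<psi> (lbracket (inv \<psi> (R (\<psi> a))) b)"
      by (simp add: br[symmetric] inv)
    also have "lbracket (\<psi> a) (R (\<psi> b)) = map_poly \<psi> (lbracket a (inv \<psi> (R (\<psi> b))))"
      by (simp add: br[symmetric] inv)
    finally show ?thesis
      unfolding comp_apply inv_br br
      by (simp add: poly_eq_iff coeff_map_poly P.add P.scale P.zero R.zero inv_0)
  qed
  with hom show ?thesis by (simp add: rota_baxter_def)
qed

end

section \<open>Coordinates and normal forms in sl2\<close>

lift_definition e_coord :: "sl2 \<Rightarrow> complex" is "\<lambda>A. A $ 1 $ 2" .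
lift_definition f_coord :: "sl2 \<Rightarrow> complex" is "\<lambda>A. A $ 2 $ 1" .
lift_definition h_coord :: "sl2 \<Rightarrow> complex" is "\<lambda>A. A $ 1 $ 1" .

lemma sl2_coord_entry: "Rep_sl2 x $ 2 $ 2 = - h_coord x"
  using Rep_sl2[of x] by (simp add: h_coord.rep_eq trace_def sum_2 eq_neg_iff_add_eq_0 add.commute)

lemma sl2_coord_simps [simp]:
  "e_coord 0 = 0" "f_coord 0 = 0" "h_coord 0 = 0"
  "e_coord (x + y) = e_coord x + e_coord y" "f_coord (x + y) = f_coord x + f_coord y"
  "h_coord (x + y) = h_coord x + h_coord y"
  "e_coord (x - y) = e_coord x - e_coord y" "f_coord (x - y) = f_coord x - f_coord y"
  "h_coord (x - y) = h_coord x - h_coord y"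
  "e_coord (- x) = - e_coord x" "f_coord (- x) = - f_coord x" "h_coord (- x) = - h_coord x"
  "e_coord (sl2_scale c x) = c * e_coord x" "f_coord (sl2_scale c x) = c * f_coord x"
  "h_coord (sl2_scale c x) = c * h_coord x"
  "e_coord sl2_e = 1" "f_coord sl2_e = 0" "h_coord sl2_e = 0"
  "e_coord sl2_f = 0" "f_coord sl2_f = 1" "h_coord sl2_f = 0"
  "e_coord sl2_h = 0" "f_coord sl2_h = 0" "h_coord sl2_h = 1"
  by (transfer, simp)+

lemma sl2_coord_bracket [simp]:
  "e_coord (sl2_bracket x y) = 2 * (h_coord x * e_coord y - e_coord x * h_coord y)"
  "f_coord (sl2_bracket x y) = 2 * (f_coord x * h_coord y - h_coord x * f_coord y)"
  "h_coord (sl2_bracket x y) = e_coord x * f_coord y - f_coord x * e_coord y"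
  by (simp_all add: e_coord.rep_eq f_coord.rep_eq h_coord.rep_eq sl2_bracket.rep_eq
      matrix_matrix_mult_def sum_2)
    (simp_all add: sl2_coord_entry e_coord.rep_eq[symmetric] f_coord.rep_eq[symmetric]
      h_coord.rep_eq[symmetric] algebra_simps)

lemma sl2_coord_sum:
  "e_coord (sum g I) = (\<Sum>i\<in>I. e_coord (g i))"
  "f_coord (sum g I) = (\<Sum>i\<in>I. f_coord (g i))"
  "h_coord (sum g I) = (\<Sum>i\<in>I. h_coord (g i))"
  by (induction I rule: infinite_finite_induct) auto

lemma sl2_expand:
  "x = sl2_scale (e_coord x) sl2_e + sl2_scale (f_coord x) sl2_f + sl2_scale (h_coord x) sl2_h"
  using sl2_span[of x] by auto

lemma sl2_eq_iff:
  "x = y \<longleftrightarrow> e_coord x = e_coord y \<and> f_coord x = f_coord y \<and> h_coord x = h_coord y"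
  by (metis sl2_expand)

lemma sl2_basis_nonzero [simp]: "sl2_e \<noteq> 0" "sl2_f \<noteq> 0" "sl2_h \<noteq> 0"
  by (auto simp: sl2_eq_iff)

text \<open>
  This is \<open>exp(\<tau> ad e)\<close>: it fixes \<open>e\<close> and maps \<open>h\<close> to \<open>h - 2\<tau> e\<close> and \<open>f\<close> to \<open>f + \<tau> h - \<tau>\<^sup>2 e\<close>.
\<close>

definition sl2_exp :: "complex \<Rightarrow> sl2 \<Rightarrow> sl2" where
  "sl2_exp \<tau> x = sl2_scale (e_coord x - 2 * \<tau> * h_coord x - \<tau>\<^sup>2 * f_coord x) sl2_e +
     sl2_scale (f_coord x) sl2_f + sl2_scale (h_coord x + \<tau> * f_coord x) sl2_h"

text \<open>
  Conjugation by the permutation matrix.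
\<close>

definition sl2_swap :: "sl2 \<Rightarrow> sl2" where
  "sl2_swap x = sl2_scale (f_coord x) sl2_e + sl2_scale (e_coord x) sl2_f + sl2_scale (- h_coord x) sl2_h"

lemma sl2_lie_automorphismI:
  assumes "\<And>x y. \<phi> (x + y) = \<phi> x + \<phi> y" "\<And>c x. \<phi> (sl2_scale c x) = sl2_scale c (\<phi> x)"
    and "\<And>x y. sl2_bracket (\<phi> x) (\<phi> y) = \<phi> (sl2_bracket x y)"
    and "\<And>x. \<psi> (\<phi> x) = x" "\<And>x. \<phi> (\<psi> x) = x"
  shows "sl2.lie_automorphism \<phi>"
proof -
  have "Vector_Spaces.linear sl2_scale sl2_scale \<phi>"
    by unfold_locales (rule assms)+
  moreover have "bij \<phi>" by (rule bijI'[of \<phi>]) (metis assms(4,5))+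
  ultimately show ?thesis using assms(3) by (simp add: sl2.lie_automorphism_def)
qed

lemma sl2_exp_inverse: "sl2_exp (- \<tau>) (sl2_exp \<tau> x) = x"
  by (simp add: sl2_exp_def sl2_eq_iff algebra_simps power2_eq_square)

lemma lie_automorphism_sl2_exp: "sl2.lie_automorphism (sl2_exp \<tau>)"
  by (rule sl2_lie_automorphismI[where \<psi> = "sl2_exp (- \<tau>)"])
    (use sl2_exp_inverse[of "- \<tau>"] in
      \<open>simp_all add: sl2_exp_inverse\<close>,
     simp_all add: sl2_exp_def sl2_eq_iff algebra_simps power2_eq_square)

lemma sl2_swap_swap: "sl2_swap (sl2_swap x) = x"
  by (simp add: sl2_swap_def sl2_eq_iff)

lemma lie_automorphism_sl2_swap: "sl2.lie_automorphism sl2_swap"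
  by (rule sl2_lie_automorphismI[where \<psi> = sl2_swap, OF _ _ _ sl2_swap_swap sl2_swap_swap])
    (simp_all add: sl2_swap_def sl2_eq_iff algebra_simps)

text \<open>
  If the \<open>f\<close>-coordinate of \<open>v\<close> vanishes, then \<open>v = a e + c h\<close> is a multiple of \<open>e\<close>, or \<open>c \<noteq> 0\<close> and a
  unipotent map removes \<open>a e\<close>. Otherwise a unipotent map can make the \<open>e\<close>-coordinate vanish, since over
  \<open>\<complex>\<close> the quadratic equation for its parameter has a root, and exchanging \<open>e\<close> and \<open>f\<close> leads back to the
  first case.
\<close>

lemma sl2_normal_form:
  assumes "v \<noteq> 0"
  obtains \<phi> \<mu> where "sl2.lie_automorphism \<phi>" "\<mu> \<noteq> 0"
    "v = \<phi> (sl2_scale \<mu> sl2_h) \<or> v = \<phi> (sl2_scale \<mu> sl2_e)"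
proof -
  define good where "good w \<longleftrightarrow> (\<exists>\<phi> \<mu>. sl2.lie_automorphism \<phi> \<and> \<mu> \<noteq> 0 \<and>
    (w = \<phi> (sl2_scale \<mu> sl2_h) \<or> w = \<phi> (sl2_scale \<mu> sl2_e)))" for w
  have pull: "good w" if "good (\<psi> w)" "sl2.lie_automorphism \<psi>'" "\<psi>' (\<psi> w) = w" for \<psi> \<psi>' w
    using that sl2.lie_automorphism_comp[of \<psi>'] unfolding good_def by (metis comp_apply)
  have upper: "good w" if w: "f_coord w = 0" "w \<noteq> 0" for w
  proof (cases "h_coord w = 0")
    case True
    then have "w = sl2_exp 0 (sl2_scale (e_coord w) sl2_e)" "e_coord w \<noteq> 0"
      using w by (auto simp: sl2_exp_def sl2_eq_iff)
    then show ?thesis unfolding good_def using lie_automorphism_sl2_exp by blast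
  next
    case False
    then have "w = sl2_exp (- e_coord w / (2 * h_coord w)) (sl2_scale (h_coord w) sl2_h)"
      using w by (simp add: sl2_exp_def sl2_eq_iff)
    then show ?thesis unfolding good_def using lie_automorphism_sl2_exp False by blast
  qed
  have "good v"
  proof (cases "f_coord v = 0")
    case True
    then show ?thesis using upper assms by simp
  next
    case False
    \<comment> \<open>A root of the quadratic equation saying that the new \<open>e\<close>-coordinate is 0.\<close>
    define \<tau> where "\<tau> = (csqrt ((h_coord v)\<^sup>2 + e_coord v * f_coord v) - h_coord v) / f_coord v"
    have "(\<tau> * f_coord v + h_coord v)\<^sup>2 = (h_coord v)\<^sup>2 + e_coord v * f_coord v"
      using False by (simp add: \<tau>_def)
    then have "f_coord v * (e_coord v - 2 * \<tau> * h_coord v - \<tau>\<^sup>2 * f_coord v) = 0"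
      by (simp add: algebra_simps power2_eq_square)
    then have root: "e_coord v - 2 * \<tau> * h_coord v - \<tau>\<^sup>2 * f_coord v = 0"
      using False by simp
    have "good (sl2_swap (sl2_exp \<tau> v))"
    proof (rule upper)
      show "f_coord (sl2_swap (sl2_exp \<tau> v)) = 0"
        using root by (simp add: sl2_swap_def sl2_exp_def)
      have "e_coord (sl2_swap (sl2_exp \<tau> v)) \<noteq> 0"
        using False by (simp add: sl2_swap_def sl2_exp_def)
      then show "sl2_swap (sl2_exp \<tau> v) \<noteq> 0" by auto
    qed
    then have "good (sl2_exp \<tau> v)"
      using pull lie_automorphism_sl2_swap sl2_swap_swap by blast
    then show ?thesis
      using pull lie_automorphism_sl2_exp sl2_exp_inverse by blast
  qed
  then show ?thesis using that unfolding good_def by blast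
qed

section \<open>The component of highest degree\<close>

lemma sum_eq_two:
  assumes "p \<in> I" "q \<in> I" "p \<noteq> q" "finite I" and "\<And>i. i \<in> I \<Longrightarrow> i \<noteq> p \<Longrightarrow> i \<noteq> q \<Longrightarrow> g i = 0"
  shows "sum g I = g p + g q"
proof -
  have "sum g I = sum g {p, q}"
    using assms by (intro sum.mono_neutral_right) auto
  then show ?thesis using assms by simp
qed

text \<open>
  The components of a Rota--Baxter operator of weight 1 whose degree in \<open>\<partial>\<close> is at most \<open>n > 0\<close>, seen as
  a family of linear maps. Everything about the highest degree follows from the two families of
  identities alone.
\<close>

locale rb_family =
  fixes A :: "nat \<Rightarrow> sl2 \<Rightarrow> sl2" and n :: nat
  assumes linear: "Vector_Spaces.linear sl2_scale sl2_scale (A i)"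
    and rb0: "sl2_bracket (A 0 x) (A m y) =
      A m (sl2_bracket (A 0 x + x) y) + (\<Sum>i\<le>m. A i (sl2_bracket x (A (m - i) y)))"
    and rb1: "sl2_scale (of_nat (m + 1)) (sl2_bracket (A 0 x) (A (m + 1) y)) -
      sl2_bracket (A 1 x) (A m y) =
      (\<Sum>i\<le>m. A i (sl2_scale (of_nat (m - i + 1)) (sl2_bracket x (A (m - i + 1) y)))) -
      A m (sl2_bracket (A 1 x) y)"
    and above_top: "n < i \<Longrightarrow> A i x = 0"
    and top_pos: "0 < n"
begin

lemma A_add: "A i (x + y) = A i x + A i y"
proof -
  interpret Vector_Spaces.linear sl2_scale sl2_scale "A i" by (rule linear)
  show ?thesis by (rule add)
qed

lemma A_scale: "A i (sl2_scale c x) = sl2_scale c (A i x)"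
proof -
  interpret Vector_Spaces.linear sl2_scale sl2_scale "A i" by (rule linear)
  show ?thesis by (rule scale)
qed

lemma A_zero: "A i 0 = 0"
  using A_scale[of i 0 0] by simp

lemma A_expand:
  "A i x = sl2_scale (e_coord x) (A i sl2_e) + sl2_scale (f_coord x) (A i sl2_f) +
    sl2_scale (h_coord x) (A i sl2_h)"
  by (subst (1) sl2_expand[of x]) (simp only: A_add A_scale)

lemmas A_bracket = A_expand[of _ "sl2_bracket x y" for x y]

text \<open>
  In degree \<open>2n\<close> the only product that does not exceed the highest degree is that of \<open>A n\<close> with itself.
\<close>

lemma top_bracket_top: "A n (sl2_bracket x (A n y)) = 0"
proof -
  have "(\<Sum>i\<le>2 * n. A i (sl2_bracket x (A (2 * n - i) y))) =
      (\<Sum>i\<le>2 * n. if i = n then A n (sl2_bracket x (A n y)) else 0)"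
  proof (intro sum.cong refl)
    fix i
    consider "i < n" | "i = n" | "n < i" by linarith
    then show "A i (sl2_bracket x (A (2 * n - i) y)) =
        (if i = n then A n (sl2_bracket x (A n y)) else 0)"
      by cases (simp_all add: above_top A_zero)
  qed
  then show ?thesis
    using rb0[of x "2 * n" y] above_top[of "2 * n"] top_pos by simp
qed

text \<open>
  In degree \<open>n + k\<close> the products \<open>A i\<close>, \<open>A j\<close> have \<open>i + j = n + k\<close>; those with \<open>i, j \<le> n\<close> and
  \<open>{i, j} \<noteq> {k, n}\<close> have both indices strictly above \<open>k\<close>. Hence \<open>mid\<close>, which is available in a downward
  induction on \<open>k\<close>, leaves the pair of \<open>A k\<close> and \<open>A n\<close> only.
\<close>

lemma cross_relation:
  assumes "0 < k" "k < n"
    and mid: "\<And>i j. k < i \<Longrightarrow> k < j \<Longrightarrow> A i (sl2_bracket x (A j y)) = 0"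
  shows "A n (sl2_bracket x (A k y)) + A k (sl2_bracket x (A n y)) = 0"
proof -
  have "(\<Sum>i\<le>n + k. A i (sl2_bracket x (A (n + k - i) y))) =
      A n (sl2_bracket x (A (n + k - n) y)) + A k (sl2_bracket x (A (n + k - k) y))"
  proof (rule sum_eq_two)
    fix i assume "i \<in> {..n + k}" "i \<noteq> n" "i \<noteq> k"
    then consider "i < k" | "k < i" "k < n + k - i" | "n < i" by force
    then show "A i (sl2_bracket x (A (n + k - i) y)) = 0"
      by cases (simp_all add: above_top A_zero mid)
  qed (use assms in auto)
  then show ?thesis
    using rb0[of x "n + k" y] assms by (simp add: above_top)
qed

text \<open>
  The same two products in the first-order identity carry the different weights \<open>k\<close> and \<open>n\<close>, which come
  from differentiating \<open>\<partial>\<^sup>k\<close> and \<open>\<partial>\<^sup>n\<close>. So this relation is independent of the previous one, and the two together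
  separate the products. For \<open>k \<ge> 2\<close> the right side has degree above \<open>n\<close> and vanishes.
\<close>

lemma weighted_cross_relation:
  assumes "0 < k" "k < n"
    and mid: "\<And>i j. k < i \<Longrightarrow> k < j \<Longrightarrow> A i (sl2_bracket x (A j y)) = 0"
  shows "sl2_scale (of_nat k) (A n (sl2_bracket x (A k y))) +
      sl2_scale (of_nat n) (A k (sl2_bracket x (A n y))) =
      A (n + k - 1) (sl2_bracket (A 1 x) y) - sl2_bracket (A 1 x) (A (n + k - 1) y)"
proof -
  let ?m = "n + k - 1"
  have Suc: "?m + 1 = n + k" using assms by simp
  have "(\<Sum>i\<le>?m. A i (sl2_scale (of_nat (?m - i + 1)) (sl2_bracket x (A (?m - i + 1) y)))) =
      A n (sl2_scale (of_nat (?m - n + 1)) (sl2_bracket x (A (?m - n + 1) y))) +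
      A k (sl2_scale (of_nat (?m - k + 1)) (sl2_bracket x (A (?m - k + 1) y)))"
  proof (rule sum_eq_two)
    fix i assume i: "i \<in> {..?m}" "i \<noteq> n" "i \<noteq> k"
    then consider "i < k" | "k < i" "k < ?m - i + 1" | "n < i" using assms by force
    then show "A i (sl2_scale (of_nat (?m - i + 1)) (sl2_bracket x (A (?m - i + 1) y))) = 0"
    proof cases
      case 1
      then have "n < ?m - i + 1" using assms by simp
      then show ?thesis by (simp only: above_top) (simp add: A_zero)
    next
      case 2
      then show ?thesis by (simp only: A_scale mid) simp
    qed (simp add: above_top)
  qed (use assms in auto)
  moreover have "?m - n + 1 = k" "?m - k + 1 = n" using assms by simp_all
  ultimately have S: "(\<Sum>i\<le>?m. A i (sl2_scale (of_nat (?m - i + 1)) (sl2_bracket x (A (?m - i + 1) y)))) =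
      sl2_scale (of_nat k) (A n (sl2_bracket x (A k y))) +
      sl2_scale (of_nat n) (A k (sl2_bracket x (A n y)))"
    by (simp only: A_scale)
  have "A (n + k) y = 0" using assms by (simp add: above_top)
  then show ?thesis
    using rb1[where m = ?m and x = x and y = y] unfolding Suc S
    by (simp add: algebra_simps)
qed

text \<open>
  For \<open>2 \<le> k < n\<close> the two cross relations form a homogeneous linear system with determinant \<open>n - k \<noteq> 0\<close>.
  The hypothesis \<open>ann\<close> is the property of a rank one map \<open>A n\<close> explained at the beginning: it places the images of
  all higher components in the image of \<open>A n\<close>, and so yields the condition on the middle products.
\<close>

lemma higher_components:
  assumes ann: "\<And>w. (\<And>x. A n (sl2_bracket x w) = 0) \<Longrightarrow> w \<in> range (A n)"
    and "2 \<le> k" "k \<le> n"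
  shows "A n (sl2_bracket x (A k y)) = 0 \<and> A k (sl2_bracket x (A n y)) = 0"
  using assms(2,3)
proof (induction "n - k" arbitrary: k x y rule: less_induct)
  case less
  show ?case
  proof (cases "k = n")
    case True
    then show ?thesis by (simp add: top_bracket_top)
  next
    case False
    with less.prems have k: "0 < k" "k < n" by auto
    have mid: "A i (sl2_bracket x (A j y)) = 0" if "k < i" "k < j" for i j
    proof (cases "i \<le> n \<and> j \<le> n")
      case True
      have "A n (sl2_bracket z (A j y)) = 0" for z
        using less.hyps[of j z y] True that less.prems k by (simp add: diff_less_mono2)
      then obtain y' where "A j y = A n y'" using ann by blast
      then show ?thesis
        using less.hyps[of i x y'] True that less.prems k by (simp add: diff_less_mono2)
    next
      case False
      then show ?thesis by (auto simp: above_top A_zero)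
    qed
    have "n < n + k - 1" using less.prems by simp
    then have 1: "sl2_scale (of_nat k) (A n (sl2_bracket x (A k y))) +
        sl2_scale (of_nat n) (A k (sl2_bracket x (A n y))) = 0"
      using weighted_cross_relation[OF k mid] by (simp add: above_top)
    have 2: "A k (sl2_bracket x (A n y)) = - A n (sl2_bracket x (A k y))"
      using cross_relation[OF k mid] by (simp add: eq_neg_iff_add_eq_0 add.commute)
    \<comment> \<open>Substituting \<open>2\<close> into \<open>1\<close> leaves the factor \<open>k - n\<close>.\<close>
    have "A n (sl2_bracket x (A k y)) = 0"
      using 1 k unfolding 2 by (simp add: sl2_eq_iff ring_distribs[symmetric])
    with 2 show ?thesis by simp
  qed
qed

text \<open>
  With this the cross relations hold for \<open>k = 1\<close> too, where the right side of the weighted one need not vanish.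
\<close>

lemma middle_vanishes:
  assumes ann: "\<And>w. (\<And>x. A n (sl2_bracket x w) = 0) \<Longrightarrow> w \<in> range (A n)"
    and "2 \<le> i" "2 \<le> j"
  shows "A i (sl2_bracket x (A j y)) = 0"
proof (cases "i \<le> n \<and> j \<le> n")
  case True
  then have "A n (sl2_bracket z (A j y)) = 0" for z
    using higher_components[OF ann] assms by blast
  then obtain y' where "A j y = A n y'" using ann by blast
  then show ?thesis
    using higher_components[OF ann, of i x y'] True assms by simp
next
  case False
  then show ?thesis by (auto simp: above_top A_zero)
qed

text \<open>
  The degree \<open>n\<close> part of the zeroth-order identity, with the products involving \<open>A 0\<close> set apart.
\<close>

lemma top_relation:
  "sl2_bracket (A 0 x) (A n y) = A n (sl2_bracket (A 0 x + x) y) + A 0 (sl2_bracket x (A n y)) +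
     A n (sl2_bracket x (A 0 y)) + (\<Sum>i\<in>{0<..<n}. A i (sl2_bracket x (A (n - i) y)))"
proof -
  have "{..n} = insert 0 (insert n {0<..<n})" using top_pos by auto
  then show ?thesis
    using rb0[of x n y] top_pos by (simp add: add.assoc)
qed

text \<open>
  The map \<open>A n\<close> kills \<open>e\<close> and \<open>f\<close> and multiplies \<open>h\<close> by some \<open>\<nu> \<noteq> 0\<close>. Lower components of positive degree
  inherit this shape, so their products in degree \<open>n\<close> vanish. What remains of that degree says that
  \<open>A 0\<close> commutes with \<open>ad h\<close>, hence is diagonal, and that its eigenvalues on \<open>e\<close> and \<open>f\<close> add up to \<open>-1\<close>. Finally
  degree 0 says that their product is 0.
\<close>

lemma semisimple_top:
  assumes top: "A n y0 = sl2_scale \<mu> sl2_h" and \<mu>: "\<mu> \<noteq> 0"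
  shows "\<And>i. 0 < i \<Longrightarrow> A i sl2_e = 0"
    and "\<And>i. 0 < i \<Longrightarrow> A i sl2_f = 0"
    and "\<And>i. A i sl2_h = sl2_scale (h_coord (A i sl2_h)) sl2_h"
    and "A n sl2_h \<noteq> 0"
    and "A 0 sl2_e = - sl2_e \<and> A 0 sl2_f = 0 \<or> A 0 sl2_e = 0 \<and> A 0 sl2_f = - sl2_f"
proof -
  have top_e: "A n sl2_e = 0" and top_f: "A n sl2_f = 0"
    using top_bracket_top[of sl2_e y0] top_bracket_top[of sl2_f y0] \<mu>
    by (simp_all add: top A_bracket)
  have y0: "sl2_scale \<mu> sl2_h = sl2_scale (h_coord y0) (A n sl2_h)"
    using A_expand[of n y0] by (simp add: top top_e top_f)
  then have "\<mu> = h_coord y0 * h_coord (A n sl2_h)" "h_coord y0 * e_coord (A n sl2_h) = 0"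
    "h_coord y0 * f_coord (A n sl2_h) = 0"
    by (simp_all add: sl2_eq_iff)
  with \<mu> have top_h: "h_coord (A n sl2_h) \<noteq> 0" "e_coord (A n sl2_h) = 0" "f_coord (A n sl2_h) = 0"
    by auto
  define \<nu> where "\<nu> = h_coord (A n sl2_h)"
  have \<nu>: "\<nu> \<noteq> 0" using top_h by (simp add: \<nu>_def)
  have N: "A n x = sl2_scale (h_coord x * \<nu>) sl2_h" for x
    by (subst A_expand) (simp add: top_e top_f sl2_eq_iff top_h \<nu>_def)
  have ann: "w \<in> range (A n)" if "\<And>x. A n (sl2_bracket x w) = 0" for w
  proof -
    have "w = A n (sl2_scale (h_coord w / \<nu>) sl2_h)"
      using that[of sl2_e] that[of sl2_f] \<nu> by (simp add: N sl2_eq_iff)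
    then show ?thesis by blast
  qed
  have comp: "A i sl2_e = 0 \<and> A i sl2_f = 0 \<and> e_coord (A i sl2_h) = 0 \<and> f_coord (A i sl2_h) = 0"
    if i: "0 < i" for i
  proof -
    consider "i = n" | "n < i" | "2 \<le> i" "i < n" | "i = 1" "1 < n" using i by linarith
    then show ?thesis
    proof cases
      case 1
      then show ?thesis by (simp add: top_e top_f top_h)
    next
      case 2
      then show ?thesis by (simp add: above_top)
    next
      case 3
      then have "A n (sl2_bracket x (A i y)) = 0" "A i (sl2_bracket x (A n y)) = 0" for x y
        using higher_components[OF ann, of i] by auto
      from this(1)[of sl2_e sl2_h] this(1)[of sl2_f sl2_h] this(2)[of sl2_e sl2_h] this(2)[of sl2_f sl2_h]
      show ?thesis using \<nu> by (simp add: A_bracket N)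
    next
      case 4
      have mid: "A i (sl2_bracket x (A j y)) = 0" if "1 < i" "1 < j" for i j x y
        using middle_vanishes[OF ann] that by simp
      have cross: "A n (sl2_bracket x (A 1 y)) + A 1 (sl2_bracket x (A n y)) = 0" for x y
        by (rule cross_relation) (use 4 mid in auto)
      have wcross: "A n (sl2_bracket x (A 1 y)) + sl2_scale (of_nat n) (A 1 (sl2_bracket x (A n y))) =
          A n (sl2_bracket (A 1 x) y) - sl2_bracket (A 1 x) (A n y)" for x y
        using weighted_cross_relation[of 1 x y] 4 mid by simp
      have h: "e_coord (A 1 sl2_h) = 0" "f_coord (A 1 sl2_h) = 0"
        using wcross[of sl2_h sl2_h] \<nu> by (simp_all add: N sl2_eq_iff A_bracket)
      have "A 1 sl2_e = 0" "A 1 sl2_f = 0"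
        using cross[of sl2_e sl2_h] cross[of sl2_f sl2_h] \<nu> h by (simp_all add: A_bracket N)
      with h 4 show ?thesis by simp
    qed
  qed
  show e: "A i sl2_e = 0" and f: "A i sl2_f = 0" if "0 < i" for i
    using comp that by auto
  have middle: "(\<Sum>i\<in>{0<..<n}. A i (sl2_bracket x (A (n - i) y))) = 0" for x y
  proof (intro sum.neutral ballI)
    fix i assume "i \<in> {0<..<n}"
    then have "A (n - i) y = sl2_scale (h_coord y * h_coord (A (n - i) sl2_h)) sl2_h"
      by (subst A_expand) (simp add: comp sl2_eq_iff)
    with \<open>i \<in> {0<..<n}\<close> show "A i (sl2_bracket x (A (n - i) y)) = 0"
      by (simp add: A_bracket comp)
  qed
  note rel = top_relation[unfolded middle]
  have h0: "e_coord (A 0 sl2_h) = 0" "f_coord (A 0 sl2_h) = 0"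
    using rel[of sl2_h sl2_h] \<nu> by (simp_all add: N sl2_eq_iff A_bracket)
  show "A i sl2_h = sl2_scale (h_coord (A i sl2_h)) sl2_h" for i
    using h0 comp[of i] by (cases "i = 0") (simp_all add: sl2_eq_iff)
  show "A n sl2_h \<noteq> 0" using top_h by auto
  have e0: "f_coord (A 0 sl2_e) = 0" "h_coord (A 0 sl2_e) = 0"
    using arg_cong[OF rel[of sl2_e sl2_h], of f_coord] arg_cong[OF rel[of sl2_e sl2_h], of h_coord] \<nu> h0
    by (simp_all add: N A_bracket eq_neg_iff_add_eq_0 mult.commute mult_2[symmetric])
  have f0: "e_coord (A 0 sl2_f) = 0" "h_coord (A 0 sl2_f) = 0"
    using arg_cong[OF rel[of sl2_f sl2_h], of e_coord] arg_cong[OF rel[of sl2_f sl2_h], of h_coord] \<nu> h0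
    by (simp_all add: N A_bracket eq_neg_iff_add_eq_0 mult.commute mult_2[symmetric])
  have "(e_coord (A 0 sl2_e) + 1 + f_coord (A 0 sl2_f)) * \<nu> = 0"
    using arg_cong[OF rel[of sl2_e sl2_f], of h_coord] e0 f0
    by (simp add: N A_zero algebra_simps del: mult_eq_0_iff)
  then have sum: "e_coord (A 0 sl2_e) + 1 + f_coord (A 0 sl2_f) = 0"
    using \<nu> by simp
  have "A 0 (sl2_bracket (A 0 sl2_e + sl2_e) sl2_f) + A 0 (sl2_bracket sl2_e (A 0 sl2_f)) =
      sl2_scale (e_coord (A 0 sl2_e) + 1 + f_coord (A 0 sl2_f)) (A 0 sl2_h)"
    using e0 f0 by (simp add: A_bracket sl2_eq_iff algebra_simps)
  then have prod: "e_coord (A 0 sl2_e) * f_coord (A 0 sl2_f) = 0"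
    using rb0[of sl2_e 0 sl2_f] e0 f0 by (simp add: sum sl2_eq_iff)
  show "A 0 sl2_e = - sl2_e \<and> A 0 sl2_f = 0 \<or> A 0 sl2_e = 0 \<and> A 0 sl2_f = - sl2_f"
    using e0 f0 sum prod by (auto simp: sl2_eq_iff eq_neg_iff_add_eq_0 add.commute)
qed

text \<open>
  Here \<open>A n\<close> kills \<open>e\<close> and \<open>h\<close> and maps \<open>f\<close> to \<open>\<nu> e\<close> with \<open>\<nu> \<noteq> 0\<close>. The components \<open>A k\<close> with \<open>k \<ge> 2\<close> have the same
  shape. For \<open>k = 1\<close> the cross relations leave one more possibility, the map with \<open>f \<mapsto> r 1 h\<close> and
  \<open>h \<mapsto> 2 r 1 e\<close> modulo that shape, where \<open>r 1 (n - 3) = 0\<close>. It is not excluded for \<open>n = 3\<close>, but it is harmless: the coordinates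
  of the degree \<open>n\<close> identity used below are the same as for \<open>r 1 = 0\<close>. They fix the diagonal of \<open>A 0\<close>, all of
  whose entries are \<open>-1/2\<close>, and this is incompatible with the Rota--Baxter identity in degree 0.
\<close>

lemma nilpotent_top:
  assumes top: "A n y0 = sl2_scale \<mu> sl2_e" and \<mu>: "\<mu> \<noteq> 0"
  shows False
proof -
  have top_e: "A n sl2_e = 0" and top_h: "A n sl2_h = 0"
    using top_bracket_top[of sl2_h y0] top_bracket_top[of sl2_f y0] \<mu>
    by (simp_all add: top A_bracket)
  have "sl2_scale \<mu> sl2_e = sl2_scale (f_coord y0) (A n sl2_f)"
    using A_expand[of n y0] by (simp add: top top_e top_h)
  then have "\<mu> = f_coord y0 * e_coord (A n sl2_f)" "f_coord y0 * f_coord (A n sl2_f) = 0"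
    "f_coord y0 * h_coord (A n sl2_f) = 0"
    by (simp_all add: sl2_eq_iff)
  with \<mu> have top_f: "e_coord (A n sl2_f) \<noteq> 0" "f_coord (A n sl2_f) = 0" "h_coord (A n sl2_f) = 0"
    by auto
  define \<nu> where "\<nu> = e_coord (A n sl2_f)"
  have \<nu>: "\<nu> \<noteq> 0" using top_f by (simp add: \<nu>_def)
  have N: "A n x = sl2_scale (f_coord x * \<nu>) sl2_e" for x
    by (subst A_expand) (simp add: top_e top_h sl2_eq_iff top_f \<nu>_def)
  have ann: "w \<in> range (A n)" if "\<And>x. A n (sl2_bracket x w) = 0" for w
  proof -
    have "w = A n (sl2_scale (e_coord w / \<nu>) sl2_f)"
      using that[of sl2_h] that[of sl2_f] \<nu> by (simp add: N sl2_eq_iff)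
    then show ?thesis by blast
  qed
  define r where "r i = h_coord (A i sl2_f)" for i
  have higher: "A i sl2_e = 0" "A i sl2_h = 0" "f_coord (A i sl2_f) = 0" "r i = 0" if "2 \<le> i" for i
  proof -
    have "A i sl2_e = 0 \<and> A i sl2_h = 0 \<and> f_coord (A i sl2_f) = 0 \<and> r i = 0"
    proof (cases "i \<le> n")
      case True
      then have "A n (sl2_bracket x (A i y)) = 0" "A i (sl2_bracket x (A n y)) = 0" for x y
        using higher_components[OF ann, of i] that by auto
      from this(1)[of sl2_h sl2_f] this(1)[of sl2_f sl2_f] this(2)[of sl2_h sl2_f] this(2)[of sl2_f sl2_f]
      show ?thesis using \<nu> by (simp add: A_bracket N r_def)
    qed (simp add: above_top r_def)
    then show "A i sl2_e = 0" "A i sl2_h = 0" "f_coord (A i sl2_f) = 0" "r i = 0" by auto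
  qed
  have first: "A 1 sl2_e = 0" "A 1 sl2_h = sl2_scale (2 * r 1) sl2_e" "f_coord (A 1 sl2_f) = 0"
    "n = 2 \<Longrightarrow> r 1 = 0"
  proof -
    have "A 1 sl2_e = 0 \<and> A 1 sl2_h = sl2_scale (2 * r 1) sl2_e \<and> f_coord (A 1 sl2_f) = 0 \<and>
      (n = 2 \<longrightarrow> r 1 = 0)"
    proof (cases "n = 1")
      case True
      then show ?thesis using top_e top_f top_h by (simp add: r_def)
    next
      case False
      then have n: "1 < n" using top_pos by simp
      have mid: "A i (sl2_bracket x (A j y)) = 0" if "1 < i" "1 < j" for i j x y
        using middle_vanishes[OF ann] that by simp
      have cross: "A n (sl2_bracket x (A 1 y)) + A 1 (sl2_bracket x (A n y)) = 0" for x y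
        by (rule cross_relation) (use n mid in auto)
      have wcross: "A n (sl2_bracket x (A 1 y)) + sl2_scale (of_nat n) (A 1 (sl2_bracket x (A n y))) =
          A n (sl2_bracket (A 1 x) y) - sl2_bracket (A 1 x) (A n y)" for x y
        using weighted_cross_relation[of 1 x y] n mid by simp
      have h: "A 1 sl2_h = sl2_scale (2 * r 1) sl2_e"
        using cross[of sl2_f sl2_f] \<nu> by (simp add: A_bracket N r_def sl2_eq_iff)
      have f: "f_coord (A 1 sl2_f) = 0"
        using wcross[of sl2_f sl2_f] \<nu> h by (simp add: A_bracket N r_def sl2_eq_iff)
      \<comment> \<open>The term weighted by \<open>n\<close> is balanced by three others of the same size.\<close>
      have "2 * \<nu> * r 1 * (of_nat n - 3) = 0"
        using arg_cong[OF wcross[of sl2_f sl2_f], of e_coord] h f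
        by (simp add: A_bracket N r_def)
      then have "r 1 = 0" if "n = 2"
        using \<nu> that by simp
      moreover have "A 1 sl2_e = 0"
        using cross[of sl2_h sl2_f] \<nu> f by (simp add: A_bracket N)
      ultimately show ?thesis using h f by simp
    qed
    then show "A 1 sl2_e = 0" "A 1 sl2_h = sl2_scale (2 * r 1) sl2_e" "f_coord (A 1 sl2_f) = 0"
      "n = 2 \<Longrightarrow> r 1 = 0" by auto
  qed
  have comp: "A i sl2_e = 0" "A i sl2_h = sl2_scale (2 * r i) sl2_e" "f_coord (A i sl2_f) = 0"
    if i: "0 < i" for i
  proof -
    consider "2 \<le> i" | "i = 1" using i by linarith
    then show "A i sl2_e = 0" "A i sl2_h = sl2_scale (2 * r i) sl2_e" "f_coord (A i sl2_f) = 0"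
      by (cases; simp add: higher first[unfolded One_nat_def])+
  qed
  have rr: "r i = 0 \<or> r (n - i) = 0" if i: "i \<in> {0<..<n}" for i
  proof -
    consider "2 \<le> i" | "2 \<le> n - i" | "i = 1" "n = 2" using i by force
    then show ?thesis using higher(4) first(4) by cases auto
  qed
  define S where "S x y = (\<Sum>i\<in>{0<..<n}. A i (sl2_bracket x (A (n - i) y)))" for x y
  \<comment> \<open>Each summand is a product of \<open>A i\<close> and \<open>A (n - i)\<close>; its only contribution to these
      coordinates is \<open>r i * r (n - i)\<close>, up to a factor.\<close>
  have S: "f_coord (S x sl2_f) = 0" "h_coord (S x sl2_f) = 0" "e_coord (S sl2_h sl2_f) = 0"
    "e_coord (S sl2_f sl2_h) = 0" for x
    unfolding S_def sl2_coord_sum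
    by (intro sum.neutral ballI; frule rr; auto simp: A_bracket comp r_def)+
  note rel = top_relation[folded S_def]
  have e0: "f_coord (A 0 sl2_e) = 0"
    using arg_cong[OF rel[of sl2_e sl2_f], of h_coord] \<nu> by (simp add: N A_bracket S)
  have f_h: "f_coord (A 0 sl2_h) = 0"
    using arg_cong[OF rel[of sl2_f sl2_f], of f_coord] \<nu> by (simp add: N A_bracket S)
  have h_e: "h_coord (A 0 sl2_e) = 0"
    using arg_cong[OF rel[of sl2_h sl2_f], of h_coord] \<nu> f_h by (simp add: N A_bracket S)
  have h_h: "h_coord (A 0 sl2_h) = f_coord (A 0 sl2_f)"
    using arg_cong[OF rel[of sl2_f sl2_f], of h_coord] \<nu> by (simp add: N A_bracket S)
  have "2 * (\<nu> * (h_coord (A 0 sl2_h) + 1 + f_coord (A 0 sl2_f))) = 0"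
    using arg_cong[OF rel[of sl2_f sl2_h], of e_coord]
    by (simp add: N A_bracket A_zero S algebra_simps del: mult_eq_0_iff)
  then have "h_coord (A 0 sl2_h) + 1 + f_coord (A 0 sl2_f) = 0"
    using \<nu> by simp
  then have b: "f_coord (A 0 sl2_f) = - 1 / 2"
    using h_h by (simp add: field_simps eq_neg_iff_add_eq_0)
  have "\<nu> * (2 * e_coord (A 0 sl2_e)) =
      \<nu> * (2 * (h_coord (A 0 sl2_h) + 1 + f_coord (A 0 sl2_f) + h_coord (A 0 sl2_h)))"
    using arg_cong[OF rel[of sl2_h sl2_f], of e_coord]
    by (simp add: N A_bracket S algebra_simps del: mult_cancel_left)
  then have "e_coord (A 0 sl2_e) = h_coord (A 0 sl2_h) + 1 + f_coord (A 0 sl2_f) + h_coord (A 0 sl2_h)"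
    using \<nu> by (metis mult_cancel_left zero_neq_numeral)
  then have a: "e_coord (A 0 sl2_e) = - 1 / 2"
    using h_h b by simp
  show False
    using arg_cong[OF rb0[of sl2_e 0 sl2_h], of e_coord] a b e0 h_e f_h h_h by (simp add: A_bracket)
qed

end

section \<open>Classification of the operators\<close>

lemma rb_family_component:
  assumes "sl2.cur.rota_baxter 1 R" "0 < n" "\<And>i x. n < i \<Longrightarrow> sl2.component R i x = 0"
  shows "rb_family (sl2.component R) n"
proof (rule rb_family.intro)
  have hom: "module_hom sl2.cur_scale sl2.cur_scale R"
    using assms(1) by (simp add: sl2.cur.rota_baxter_def)
  show "Vector_Spaces.linear sl2_scale sl2_scale (sl2.component R i)" for i
    using hom by (rule sl2.linear_component)
qed (use assms sl2.rota_baxter_components[OF assms(1)] in auto)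

lemma components_eventually_zero:
  assumes "module_hom sl2.cur_scale sl2.cur_scale R"
  obtains d where "\<And>i x. d < i \<Longrightarrow> sl2.component R i x = 0"
proof -
  let ?d = "max (degree (R [:sl2_e:])) (max (degree (R [:sl2_f:])) (degree (R [:sl2_h:])))"
  have "sl2.component R i x = 0" if d: "?d < i" for i x
  proof -
    interpret Vector_Spaces.linear sl2_scale sl2_scale "sl2.component R i"
      using assms by (rule sl2.linear_component)
    show ?thesis
      by (subst sl2_expand[of x], simp only: add scale)
        (use d in \<open>simp add: sl2.component_def coeff_eq_0\<close>)
  qed
  then show ?thesis using that by blast
qed

lemma constant_case:
  assumes rb: "sl2.cur.rota_baxter 1 R" and const: "\<And>i x. 0 < i \<Longrightarrow> sl2.component R i x = 0"
  shows "sl2.rota_baxter 1 (sl2.component R 0)" "R = sl2.cur_extension (sl2.component R 0)"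
proof -
  have hom: "module_hom sl2.cur_scale sl2.cur_scale R"
    using rb by (simp add: sl2.cur.rota_baxter_def)
  interpret Vector_Spaces.linear sl2_scale sl2_scale "sl2.component R 0"
    using hom by (rule sl2.linear_component)
  show "sl2.rota_baxter 1 (sl2.component R 0)"
    unfolding sl2.rota_baxter_def
    using sl2.rota_baxter_components(1)[OF rb, of _ 0] sl2.linear_component[OF hom]
    by (simp add: sl2.bracket_add_left add[symmetric] add_ac)
  have "coeff (R u) m = coeff (sl2.cur_extension (sl2.component R 0) u) m" for u m
  proof -
    have "(\<Sum>i\<le>m. sl2.component R i (coeff u (m - i))) = (\<Sum>i\<le>m. if i = 0 then sl2.component R 0 (coeff u m) else 0)"
      by (intro sum.cong) (auto simp: const)
    then show ?thesis
      by (simp add: sl2.coeff_cur_hom[OF hom] sl2.cur_extension_def coeff_map_poly zero)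
  qed
  then show "R = sl2.cur_extension (sl2.component R 0)"
    by (intro ext poly_eqI)
qed

lemma Q1_from_components:
  assumes e: "\<And>i. sl2.component R i sl2_e = (if i = 0 then - sl2_e else 0)"
    and f: "\<And>i. sl2.component R i sl2_f = 0"
    and h: "\<And>i. sl2.component R i sl2_h = sl2_scale (h_coord (sl2.component R i sl2_h)) sl2_h"
    and nz: "sl2.component R n sl2_h \<noteq> 0"
  shows "\<exists>q. q \<noteq> 0 \<and> R [:sl2_e:] = - [:sl2_e:] \<and> R [:sl2_f:] = 0 \<and>
    R [:sl2_h:] = sl2.cur_scale q [:sl2_h:]"
proof (intro exI conjI)
  define q where "q = map_poly h_coord (R [:sl2_h:])"
  have coeff_q: "coeff q i = h_coord (sl2.component R i sl2_h)" for i
    by (simp add: q_def coeff_map_poly sl2.component_def)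
  show "q \<noteq> 0" using nz h[of n] by (auto simp: coeff_q[symmetric])
  show "R [:sl2_e:] = - [:sl2_e:]"
    using e by (intro poly_eqI) (auto simp: sl2.component_def coeff_pCons split: nat.splits)
  show "R [:sl2_f:] = 0"
    using f by (intro poly_eqI) (simp add: sl2.component_def)
  have "coeff (sl2.cur_scale q [:sl2_h:]) i = sl2_scale (coeff q i) sl2_h" for i
  proof -
    have "[:sl2_h:] = sl2.tensor 1 sl2_h"
      by (simp add: sl2.tensor_def one_pCons map_poly_pCons)
    then have "sl2.cur_scale q [:sl2_h:] = sl2.tensor q sl2_h"
      by (simp add: sl2.cur_scale_tensor)
    then show ?thesis by (simp add: sl2.tensor_def coeff_map_poly)
  qed
  then show "R [:sl2_h:] = sl2.cur_scale q [:sl2_h:]"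
    using h by (intro poly_eqI) (simp add: coeff_q, simp add: sl2.component_def)
qed

theorem theorem3:
  fixes R :: "sl2 poly \<Rightarrow> sl2 poly"
  assumes "sl2.cur.rota_baxter 1 R"
    and "\<not> sl2.cur.trivial_rota_baxter 1 R"
  shows "\<exists>\<psi>. sl2.cur.automorphism \<psi> \<and>
    ((\<exists>P. sl2.rota_baxter 1 P \<and> inv \<psi> \<circ> R \<circ> \<psi> = sl2.cur_extension P) \<or>
     (\<exists>q. q \<noteq> 0 \<and> module_hom sl2.cur_scale sl2.cur_scale (inv \<psi> \<circ> R \<circ> \<psi>) \<and>
          (inv \<psi> \<circ> R \<circ> \<psi>) [:sl2_e:] = - [:sl2_e:] \<and>
          (inv \<psi> \<circ> R \<circ> \<psi>) [:sl2_f:] = 0 \<and>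
          (inv \<psi> \<circ> R \<circ> \<psi>) [:sl2_h:] = sl2.cur_scale q [:sl2_h:]))"
proof (cases "\<forall>i>0. \<forall>x. sl2.component R i x = 0")
  case True
  then have P: "sl2.rota_baxter 1 (sl2.component R 0)" "R = sl2.cur_extension (sl2.component R 0)"
    using constant_case[OF assms(1)] by auto
  have "sl2.cur.automorphism id"
    unfolding sl2.cur.automorphism_def
    by (auto simp: id_def map_poly_idI sl2.cur.module_hom_ident intro: bij_id[unfolded id_def])
  moreover have "inv id \<circ> R \<circ> id = R" by simp
  ultimately show ?thesis using P by metis
next
  case False
  have hom: "module_hom sl2.cur_scale sl2.cur_scale R"
    using assms(1) by (simp add: sl2.cur.rota_baxter_def)
  obtain d where d: "\<And>i x. d < i \<Longrightarrow> sl2.component R i x = 0"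
    using components_eventually_zero[OF hom] by blast
  define n where "n = Max {i. 0 < i \<and> (\<exists>x. sl2.component R i x \<noteq> 0)}"
  have fin: "finite {i. 0 < i \<and> (\<exists>x. sl2.component R i x \<noteq> 0)}"
    by (rule finite_subset[of _ "{..d}"]) (use d in \<open>auto simp: not_less[symmetric]\<close>)
  then have "n \<in> {i. 0 < i \<and> (\<exists>x. sl2.component R i x \<noteq> 0)}"
    unfolding n_def using False by (intro Max_in) auto
  then obtain x0 where n: "0 < n" and x0: "sl2.component R n x0 \<noteq> 0" by auto
  have above: "sl2.component R i x = 0" if "n < i" for i x
    using Max_ge[OF fin, of i] that n unfolding n_def[symmetric] by fastforce
  obtain \<phi> \<mu> where \<phi>: "sl2.lie_automorphism \<phi>" and \<mu>: "\<mu> \<noteq> 0"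
    and v: "sl2.component R n x0 = \<phi> (sl2_scale \<mu> sl2_h) \<or>
      sl2.component R n x0 = \<phi> (sl2_scale \<mu> sl2_e)"
    using sl2_normal_form[OF x0] by blast
  have bij: "bij \<phi>" using \<phi> by (simp add: sl2.lie_automorphism_def)
  have inv: "inv \<phi> (\<phi> x) = x" "\<phi> (inv \<phi> x) = x" for x
    using bij by (simp_all add: bij_is_inj bij_is_surj surj_f_inv_f)
  have "\<phi> 0 = 0"
  proof -
    interpret Vector_Spaces.linear sl2_scale sl2_scale \<phi>
      using \<phi> by (simp add: sl2.lie_automorphism_def)
    show ?thesis by (rule zero)
  qed
  then have inv_0: "inv \<phi> 0 = 0" by (metis inv(1))
  let ?conj = "\<lambda>\<theta>. inv (sl2.cur_extension \<theta>) \<circ> R \<circ> sl2.cur_extension \<theta>"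
  have conj_rb: "sl2.cur.rota_baxter 1 (?conj \<theta>)" if "sl2.lie_automorphism \<theta>" for \<theta>
    using sl2.cur.rota_baxter_conj[OF sl2.automorphism_cur_extension(1)[OF that] assms(1)] .
  \<comment> \<open>Conjugation moves the image of the top component to a multiple of \<open>h\<close> or \<open>e\<close>.\<close>
  interpret C: rb_family "sl2.component (?conj \<phi>)" n
    by (rule rb_family_component[OF conj_rb[OF \<phi>] n])
      (simp only: sl2.component_conj[OF \<phi>] above inv_0)
  have "sl2.component (?conj \<phi>) n (inv \<phi> x0) = inv \<phi> (sl2.component R n x0)"
    by (simp only: sl2.component_conj[OF \<phi>] inv)
  with v have "sl2.component (?conj \<phi>) n (inv \<phi> x0) = sl2_scale \<mu> sl2_h"
    using C.nilpotent_top[of "inv \<phi> x0" \<mu>] \<mu> by (metis inv(1))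
  note S = C.semisimple_top[OF this \<mu>]
  have "\<exists>\<theta> q. sl2.lie_automorphism \<theta> \<and> q \<noteq> 0 \<and> ?conj \<theta> [:sl2_e:] = - [:sl2_e:] \<and>
    ?conj \<theta> [:sl2_f:] = 0 \<and> ?conj \<theta> [:sl2_h:] = sl2.cur_scale q [:sl2_h:]"
  proof (cases "sl2.component (?conj \<phi>) 0 sl2_f = 0")
    case True
    with S(5) have "sl2.component (?conj \<phi>) 0 sl2_e = - sl2_e" by auto
    then have "sl2.component (?conj \<phi>) i sl2_e = (if i = 0 then - sl2_e else 0)"
      and "sl2.component (?conj \<phi>) i sl2_f = 0" for i
      using True S(1,2)[of i] by (cases "i = 0"; simp only: if_True if_False)+
    from Q1_from_components[OF this S(3,4)] \<phi> show ?thesis by blast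
  next
    case False
    with S(5) have 0: "sl2.component (?conj \<phi>) 0 sl2_e = 0" "sl2.component (?conj \<phi>) 0 sl2_f = - sl2_f"
      by auto
    \<comment> \<open>The eigenvalues on \<open>e\<close> and \<open>f\<close> come in the wrong order, so \<open>e\<close> and \<open>f\<close> are exchanged.\<close>
    let ?\<theta> = "\<phi> \<circ> sl2_swap"
    have \<theta>: "sl2.lie_automorphism ?\<theta>"
      using \<phi> lie_automorphism_sl2_swap by (rule sl2.lie_automorphism_comp)
    have "inv ?\<theta> = sl2_swap \<circ> inv \<phi>"
      by (rule inv_unique_comp) (auto simp: inv sl2_swap_swap)
    then have comp: "sl2.component (?conj ?\<theta>) i x = sl2_swap (sl2.component (?conj \<phi>) i (sl2_swap x))" for i x
      by (simp only: sl2.component_conj[OF \<theta>] sl2.component_conj[OF \<phi>] comp_apply)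
    have swap: "sl2_swap sl2_e = sl2_f" "sl2_swap sl2_f = sl2_e" "sl2_swap sl2_h = - sl2_h"
      "sl2_swap 0 = 0" "sl2_swap (- x) = - sl2_swap x" for x
      by (simp_all add: sl2_swap_def sl2_eq_iff)
    have neg: "sl2.component (?conj \<phi>) i (- sl2_h) = - sl2.component (?conj \<phi>) i sl2_h" for i
      using C.A_expand[of i "- sl2_h"] by simp
    have "\<exists>q. q \<noteq> 0 \<and> ?conj ?\<theta> [:sl2_e:] = - [:sl2_e:] \<and> ?conj ?\<theta> [:sl2_f:] = 0 \<and>
        ?conj ?\<theta> [:sl2_h:] = sl2.cur_scale q [:sl2_h:]"
    proof (rule Q1_from_components[where n = n])
      fix i
      show "sl2.component (?conj ?\<theta>) i sl2_e = (if i = 0 then - sl2_e else 0)"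
        by (cases "i = 0") (simp_all only: comp swap 0 S if_True if_False, simp_all)
      show "sl2.component (?conj ?\<theta>) i sl2_f = 0"
        by (cases "i = 0") (simp_all only: comp swap 0 S)
      have h: "sl2.component (?conj ?\<theta>) i sl2_h = - sl2_swap (sl2.component (?conj \<phi>) i sl2_h)" for i
        by (simp only: comp swap neg)
      show "sl2.component (?conj ?\<theta>) i sl2_h =
          sl2_scale (h_coord (sl2.component (?conj ?\<theta>) i sl2_h)) sl2_h"
        using S(3)[of i] unfolding h sl2_eq_iff by (simp add: sl2_swap_def)
      show "sl2.component (?conj ?\<theta>) n sl2_h \<noteq> 0"
        using S(4) unfolding h by (metis neg_equal_0_iff_equal sl2_swap_swap swap(4))
    qed
    with \<theta> show ?thesis by blast
  qed
  then obtain \<theta> q where \<theta>: "sl2.lie_automorphism \<theta>" and q: "q \<noteq> 0" "?conj \<theta> [:sl2_e:] = - [:sl2_e:]"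
    "?conj \<theta> [:sl2_f:] = 0" "?conj \<theta> [:sl2_h:] = sl2.cur_scale q [:sl2_h:]" by blast
  have "module_hom sl2.cur_scale sl2.cur_scale (?conj \<theta>)"
    using conj_rb[OF \<theta>] by (simp only: sl2.cur.rota_baxter_def)
  with q sl2.automorphism_cur_extension(1)[OF \<theta>] show ?thesis by blast
qed

end
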